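(* Let $t$ be a positive odd integer. Define $$H^{\star}(x;q):= \Big(1-\frac1x\Big)\sum_{n\geq0}\frac{(x^2-1)^nq^{2n^2+n}}{(q^2;q^2)_n(-q;q^2)_{n+1}}+\frac1x\sum_{n\geq0}\frac{(x^2-1)^nq^{2n^2-n}}{(q^2;q^2)_n(-q;q^2)_n}.$$ Then, as formal power series in $q$, $$\sum_{\lambda\in \mathcal{SC}} x^{n_t(\lambda)}\, q^{\vert\lambda\vert} = (-q;q^2)_{\infty}\cdot H^{\star}(x;q^t)\cdot \big((1-x^2)q^{2t};q^{2t}\big)_{\infty}^{(t-1)/2}.$$
   Context: A partition $\lambda=(\lambda_1\ge\lambda_2\ge\dots\ge\lambda_\ell\ge 1)$ has size $|\lambda|=\sum_i\lambda_i$ (the empty partition has size $0$). Its Young diagram has $\lambda_i$ left-justified cells in row $i$. The conjugate $\lambda'$ is the partition whose Young diagram is the reflection of that of $\lambda$ in the main diagonal; $\lambda$ is self-conjugate if $\lambda=\lambda'$, and $\mathcal{SC}$ denotes the set of all self-conjugate partitions (including the empty one). The hook length of the cell $(i,j)$ in the Young diagram of $\lambda$ is the number of cells directly to its right in row $i$, plus the number of cells directly below it in column $j$, plus $1$. For a positive integer $t$, $n_t(\lambda)$ is the number of cells of $\lambda$ whose hook length equals $t$. The $q$-Pochhammer symbol is $(a;q)_0=1$, $(a;q)_n=\prod_{j=0}^{n-1}(1-aq^j)$ for $n\ge1$, and $(a;q)_\infty=\prod_{j\ge0}(1-aq^j)$. *)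

theory Defs
  imports "HOL-Analysis.Analysis" "HOL-Computational_Algebra.Formal_Power_Series"
begin

definition is_partition :: "nat list \<Rightarrow> bool" where
  "is_partition lam \<longleftrightarrow> sorted_wrt (\<ge>) lam \<and> (\<forall>p\<in>set lam. 0 < p)"

definition psize :: "nat list \<Rightarrow> nat" where
  "psize lam = sum_list lam"

definition cells :: "nat list \<Rightarrow> (nat \<times> nat) set" where
  "cells lam = {(i, j). i < length lam \<and> j < lam ! i}"

definition conjugate :: "nat list \<Rightarrow> nat list" where
  "conjugate lam = map (\<lambda>j. card {i. i < length lam \<and> j < lam ! i})
                       [0..<(if lam = [] then 0 else hd lam)]"

definition self_conjugate :: "nat list \<Rightarrow> bool" where
  "self_conjugate lam \<longleftrightarrow> conjugate lam = lam"

definition hook_length :: "nat list \<Rightarrow> nat \<Rightarrow> nat \<Rightarrow> nat" where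
  "hook_length lam i j = (lam ! i - Suc j) + (conjugate lam ! j - Suc i) + 1"

definition n_hook :: "nat \<Rightarrow> nat list \<Rightarrow> nat" where
  "n_hook t lam = card {(i, j) \<in> cells lam. hook_length lam i j = t}"

definition SC :: "nat list set" where
  "SC = {lam. is_partition lam \<and> self_conjugate lam}"

text \<open>Limits are taken in the standard (X-adic) metric topology on formal power series
  provided by the library.\<close>

definition qpoch :: "'a::field fps \<Rightarrow> 'a fps \<Rightarrow> nat \<Rightarrow> 'a fps" where
  "qpoch a q n = (\<Prod>j<n. 1 - a * q ^ j)"

definition qpoch_inf :: "'a::field fps \<Rightarrow> 'a fps \<Rightarrow> 'a fps" where
  "qpoch_inf a q = lim (\<lambda>n. qpoch a q n)"

definition fps_series :: "(nat \<Rightarrow> 'a::field fps) \<Rightarrow> 'a fps" where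
  "fps_series f = lim (\<lambda>N. \<Sum>n<N. f n)"

text \<open>H-star(x;q), with x a nonzero scalar and q a power series (q-order >= 1).\<close>
definition Hstar :: "'a::field \<Rightarrow> 'a fps \<Rightarrow> 'a fps" where
  "Hstar x q =
     (1 - fps_const (inverse x)) *
       fps_series (\<lambda>n. fps_const ((x^2 - 1)^n) * q ^ (2*n^2 + n) /
                        (qpoch (q^2) (q^2) n * qpoch (- q) (q^2) (Suc n)))
   + fps_const (inverse x) *
       fps_series (\<lambda>n. fps_const ((x^2 - 1)^n) * q ^ (2*n^2 - n) /
                        (qpoch (q^2) (q^2) n * qpoch (- q) (q^2) n))"

definition sc_gf :: "nat \<Rightarrow> 'a::field \<Rightarrow> 'a fps" where
  "sc_gf t x = Abs_fps (\<lambda>N. \<Sum>lam\<in>{lam\<in>SC. psize lam = N}. x ^ n_hook t lam)"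

end

theory Submission
  imports Defs
begin

text \<open>A self-conjugate partition is determined by the set \<open>D\<close> of the numbers \<open>d\<close> such that
  \<open>2 * d + 1\<close> is one of its principal hook lengths. Its beta numbers are then \<open>D\<close> and the
  numbers \<open>-1 - e\<close> with \<open>e \<notin> D\<close>, and hooks of length \<open>t\<close> are the pairs consisting of a beta
  number \<open>s\<close> and a non-beta number \<open>s - t\<close>. Splitting by residues modulo \<open>t\<close> factors the
  generating function: the residue \<open>(t - 1) / 2\<close> is its own mirror image and the remaining
  ones form \<open>(t - 1) / 2\<close> mirror pairs \<open>r, t - 1 - r\<close>. In each class the weight depends only
  on the occupied sites and on the number of rises (an empty site followed by an occupied
  one), so the sum satisfies a two-state transfer recurrence, whose solutions are explicit
  \<open>q\<close>-series. For the self-mirrored class these are the two series in \<open>Hstar\<close>. For a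
  pair, the bilateral sum tends to an Euler series, which gives the product
  \<open>((1 - x^2) q^(2t); q^(2t))\<close> without recourse to the triple product identity.\<close>

unbundle no vec_syntax
unbundle fps_syntax


subsection \<open>Limits of formal power series\<close>

text \<open>Agreement of coefficients below \<open>k\<close> is phrased as divisibility, so that
  error bounds combine through the rules for \<open>dvd\<close>.\<close>

lemma fps_X_power_dvd_iff: "fps_X ^ k dvd f \<longleftrightarrow> (\<forall>i<k. f $ i = 0)"
  for f :: "'a::field fps"
proof
  assume "fps_X ^ k dvd f"
  then show "\<forall>i<k. f $ i = 0"
    by (auto simp: fps_X_power_mult_nth elim!: dvdE)
next
  assume *: "\<forall>i<k. f $ i = 0"
  have "f = fps_X ^ k * fps_shift k f"
    by (rule fps_ext) (use * in \<open>simp add: fps_X_power_mult_nth\<close>)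
  then show "fps_X ^ k dvd f"
    by (metis dvd_triv_left)
qed

lemma tendsto_fps_mult [tendsto_intros]:
  fixes f g :: "'b \<Rightarrow> 'a::field fps"
  assumes "(f \<longlongrightarrow> a) F" "(g \<longlongrightarrow> b) F"
  shows "((\<lambda>x. f x * g x) \<longlongrightarrow> a * b) F"
proof (rule tendsto_fpsI)
  fix n
  have "\<forall>\<^sub>F x in F. \<forall>k\<in>{..n}. f x $ k = a $ k \<and> g x $ k = b $ k"
    using assms by (intro eventually_ball_finite) (auto simp: tendsto_fps_iff intro: eventually_conj)
  then show "\<forall>\<^sub>F x in F. (f x * g x) $ n = (a * b) $ n"
    by eventually_elim (simp add: fps_mult_nth)
qed

lemma tendsto_fps_add [tendsto_intros]:
  fixes f g :: "'b \<Rightarrow> 'a::field fps"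
  assumes "(f \<longlongrightarrow> a) F" "(g \<longlongrightarrow> b) F"
  shows "((\<lambda>x. f x + g x) \<longlongrightarrow> a + b) F"
proof (rule tendsto_fpsI)
  fix n
  show "\<forall>\<^sub>F x in F. (f x + g x) $ n = (a + b) $ n"
    using assms[unfolded tendsto_fps_iff, rule_format, of n] by eventually_elim simp
qed

lemma tendsto_fps_prod [tendsto_intros]:
  fixes f :: "'i \<Rightarrow> 'b \<Rightarrow> 'a::field fps"
  assumes "\<And>i. i \<in> I \<Longrightarrow> (f i \<longlongrightarrow> L i) F"
  shows "((\<lambda>x. \<Prod>i\<in>I. f i x) \<longlongrightarrow> (\<Prod>i\<in>I. L i)) F"
  using assms by (induction I rule: infinite_finite_induct) (auto intro!: tendsto_fps_mult)

lemma LIMSEQ_fpsI_dvd: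
  fixes F :: "nat \<Rightarrow> 'a::field fps"
  assumes "\<And>n. fps_X ^ n dvd F n - L"
  shows "F \<longlonglongrightarrow> L"
proof (rule tendsto_fpsI)
  fix k
  have "\<forall>\<^sub>F n in sequentially. k < n" by (rule eventually_gt_at_top)
  then show "\<forall>\<^sub>F n in sequentially. F n $ k = L $ k"
    by eventually_elim (use assms in \<open>auto simp: fps_X_power_dvd_iff\<close>)
qed

text \<open>Coefficient \<open>k\<close> of \<open>F n\<close> is frozen once \<open>n > k\<close>,
  so the limit can be written down by reading it off at \<open>n = Suc k\<close>.\<close>

lemma fps_convergentI:
  fixes F :: "nat \<Rightarrow> 'a::field fps"
  assumes "\<And>n. fps_X ^ n dvd F (Suc n) - F n"
  shows "F \<longlonglongrightarrow> lim F"
proof -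
  define L where "L = Abs_fps (\<lambda>k. F (Suc k) $ k)"
  have eq: "F n $ k = F (Suc k) $ k" if "k < n" for k n
    using that
  proof (induction n)
    case (Suc n)
    show ?case
    proof (cases "k = n")
      case False
      then have "k < n" using Suc.prems by simp
      moreover from this have "(F (Suc n) - F n) $ k = 0"
        using assms[of n] unfolding fps_X_power_dvd_iff by blast
      ultimately show ?thesis using Suc.IH by simp
    qed auto
  qed simp
  have "fps_X ^ n dvd F n - L" for n
    by (simp add: fps_X_power_dvd_iff L_def eq[of _ n])
  then have "F \<longlonglongrightarrow> L" by (rule LIMSEQ_fpsI_dvd)
  then show ?thesis by (simp add: limI)
qed

lemma fps_X_power_dvd_power:
  fixes f :: "'a::field fps"
  assumes "f $ 0 = 0"
  shows "fps_X ^ n dvd f ^ n"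
  using assms fps_X_power_dvd_iff[of 1 f] by (intro dvd_power_same) simp


subsection \<open>Series\<close>

text \<open>The index shift admits \<open>ybi\<close> below, whose \<open>n\<close>-th term need only be divisible by
  the power \<open>n - 1\<close>.\<close>
definition rapid :: "(nat \<Rightarrow> 'a::field fps) \<Rightarrow> bool" where
  "rapid f \<longleftrightarrow> (\<forall>n. fps_X ^ n dvd f (Suc n))"

lemma rapidI: "(\<And>n. fps_X ^ n dvd f n) \<Longrightarrow> rapid f"
  unfolding rapid_def by (meson dvd_trans le_imp_power_dvd le_SucI order_refl)

lemma fps_series_LIMSEQ:
  assumes "rapid f"
  shows "(\<lambda>N. \<Sum>n<N. f n) \<longlonglongrightarrow> fps_series f"
proof -
  have "(\<lambda>N. \<Sum>n<Suc N. f n) \<longlonglongrightarrow> lim (\<lambda>N. \<Sum>n<Suc N. f n)"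
    by (rule fps_convergentI) (use assms in \<open>simp add: rapid_def\<close>)
  then have "convergent (\<lambda>N. \<Sum>n<N. f n)"
    by (subst convergent_Suc_iff[symmetric]) (auto simp: convergent_def)
  then show ?thesis
    by (simp add: fps_series_def convergent_LIMSEQ_iff)
qed

lemma fps_series_eqI: "(\<lambda>N. \<Sum>n<N. f n) \<longlonglongrightarrow> L \<Longrightarrow> fps_series f = L"
  by (simp add: fps_series_def limI)

lemma fps_series_cmult: "rapid f \<Longrightarrow> fps_series (\<lambda>n. c * f n) = c * fps_series f"
  by (rule fps_series_eqI, subst sum_distrib_left[symmetric])
     (intro tendsto_intros fps_series_LIMSEQ)

lemma fps_series_add:
  "rapid f \<Longrightarrow> rapid g \<Longrightarrow> fps_series (\<lambda>n. f n + g n) = fps_series f + fps_series g"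
  by (rule fps_series_eqI, subst sum.distrib) (intro tendsto_intros fps_series_LIMSEQ)

lemma fps_series_Suc:
  assumes "rapid f"
  shows "fps_series f = f 0 + fps_series (\<lambda>n. f (Suc n))"
proof -
  have "fps_X ^ n dvd f (Suc (Suc n))" for n
    using assms unfolding rapid_def by (metis dvd_trans le_imp_power_dvd le_SucI order_refl)
  then have "rapid (\<lambda>n. f (Suc n))"
    by (simp add: rapid_def)
  then have "(\<lambda>N. f 0 + (\<Sum>n<N. f (Suc n))) \<longlonglongrightarrow> f 0 + fps_series (\<lambda>n. f (Suc n))"
    by (intro tendsto_intros fps_series_LIMSEQ)
  then have "(\<lambda>N. \<Sum>n<Suc N. f n) \<longlonglongrightarrow> f 0 + fps_series (\<lambda>n. f (Suc n))"
    by (simp only: sum.lessThan_Suc_shift)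
  then show ?thesis
    by (intro fps_series_eqI) (rule LIMSEQ_imp_Suc)
qed

text \<open>Terms with index at least \<open>k + 2\<close> do not reach coefficient
  \<open>k\<close>; the bound \<open>Suc k\<close> reflects the index shift in
  \<open>rapid\<close>.\<close>

lemma fps_series_nth:
  assumes "rapid f"
  shows "fps_series f $ k = (\<Sum>n\<le>Suc k. f n $ k)"
proof -
  have *: "(\<Sum>n<N. f n) $ k = (\<Sum>n\<le>Suc k. f n $ k)" if "N \<ge> Suc (Suc k)" for N
    using that
  proof (induction N rule: dec_induct)
    case base
    show ?case by (simp only: fps_sum_nth lessThan_Suc_atMost)
  next
    case (step N)
    have "f N $ k = 0"
      using assms step(1) unfolding rapid_def fps_X_power_dvd_iff
      by (metis Suc_le_D Suc_le_eq Suc_le_mono)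
    with step show ?case by simp
  qed
  have "\<forall>\<^sub>F N in sequentially. (\<Sum>n<N. f n) $ k = fps_series f $ k"
    using fps_series_LIMSEQ[OF assms] by (simp add: tendsto_fps_iff)
  moreover have "\<forall>\<^sub>F N in sequentially. (\<Sum>n<N. f n) $ k = (\<Sum>n\<le>Suc k. f n $ k)"
    using eventually_ge_at_top[of "Suc (Suc k)"] by eventually_elim (rule *)
  ultimately have "\<forall>\<^sub>F N :: nat in sequentially. fps_series f $ k = (\<Sum>n\<le>Suc k. f n $ k)"
    by eventually_elim simp
  then show ?thesis by simp
qed

lemma fps_X_power_dvd_series:
  assumes "rapid f" "\<And>n. fps_X ^ k dvd f n"
  shows "fps_X ^ k dvd fps_series f"
  using assms(2) by (auto simp: fps_X_power_dvd_iff fps_series_nth[OF assms(1)] intro!: sum.neutral)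

text \<open>Termwise limits suffice because \<open>rapid\<close> cuts off coefficient
  \<open>k\<close> at the same index for every \<open>N\<close>.\<close>

lemma tendsto_fps_series:
  assumes "\<And>N. rapid (f N)" "rapid g" "\<And>n. ((\<lambda>N. f N n) \<longlongrightarrow> g n) F"
  shows "((\<lambda>N. fps_series (f N)) \<longlongrightarrow> fps_series g) F"
proof (rule tendsto_fpsI)
  fix k
  have "\<forall>\<^sub>F N in F. \<forall>n\<in>{..Suc k}. f N n $ k = g n $ k"
    using assms(3) by (intro eventually_ball_finite) (auto simp: tendsto_fps_iff)
  then show "\<forall>\<^sub>F N in F. fps_series (f N) $ k = fps_series g $ k"
    by eventually_elim (simp add: fps_series_nth assms)
qed

subsection \<open>Infinite products\<close>

lemma qpoch_0 [simp]: "qpoch a q 0 = 1"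
  by (simp add: qpoch_def)

lemma qpoch_Suc: "qpoch a q (Suc n) = qpoch a q n * (1 - a * q ^ n)"
  by (simp add: qpoch_def)

lemma qpoch_add: "qpoch a q (m + n) = qpoch a q m * qpoch (a * q ^ m) q n"
  by (induction n) (simp_all add: qpoch_Suc power_add algebra_simps)

lemma qpoch_nth_0: "a $ 0 = 0 \<Longrightarrow> qpoch a q n $ 0 = 1"
  by (induction n) (simp_all add: qpoch_Suc)

lemma qpoch_inf_LIMSEQ:
  fixes a q :: "'a::field fps"
  assumes "q $ 0 = 0"
  shows "qpoch a q \<longlonglongrightarrow> qpoch_inf a q"
  unfolding qpoch_inf_def
proof (rule fps_convergentI)
  fix n
  have "qpoch a q (Suc n) - qpoch a q n = q ^ n * (- a * qpoch a q n)"
    by (simp add: qpoch_Suc algebra_simps)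
  then show "fps_X ^ n dvd qpoch a q (Suc n) - qpoch a q n"
    using fps_X_power_dvd_power[OF assms, of n] by (metis dvd_mult2)
qed

lemma qpoch_inf_split:
  fixes a q :: "'a::field fps"
  assumes "q $ 0 = 0"
  shows "qpoch_inf a q = qpoch a q n * qpoch_inf (a * q ^ n) q"
proof (rule LIMSEQ_unique)
  have "(\<lambda>N. qpoch a q (n + N)) \<longlonglongrightarrow> qpoch a q n * qpoch_inf (a * q ^ n) q"
    unfolding qpoch_add by (intro tendsto_intros qpoch_inf_LIMSEQ assms)
  then show "qpoch a q \<longlonglongrightarrow> qpoch a q n * qpoch_inf (a * q ^ n) q"
    by (subst (asm) add.commute) (rule LIMSEQ_offset)
qed (rule qpoch_inf_LIMSEQ[OF assms])

lemma qpoch_inf_rec: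
  "q $ 0 = 0 \<Longrightarrow> qpoch_inf a q = (1 - a) * qpoch_inf (a * q) q"
  using qpoch_inf_split[of q a 1] by (simp add: qpoch_Suc)

text \<open>Every partial product is congruent to 1, and each coefficient of the limit is attained
  by some partial product.\<close>

lemma fps_X_power_dvd_qpoch_inf:
  fixes a q :: "'a::field fps"
  assumes "q $ 0 = 0" "fps_X ^ k dvd a"
  shows "fps_X ^ k dvd qpoch_inf a q - 1"
proof -
  have fin: "fps_X ^ k dvd qpoch a q n - 1" for n
  proof (induction n)
    case (Suc n)
    have "qpoch a q (Suc n) - 1 = (qpoch a q n - 1) - a * (q ^ n * qpoch a q n)"
      by (simp add: qpoch_Suc algebra_simps)
    then show ?case using Suc assms(2) by (metis dvd_diff dvd_mult2)
  qed simp
  show ?thesis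
    unfolding fps_X_power_dvd_iff
  proof safe
    fix i assume "i < k"
    have "\<forall>\<^sub>F n in sequentially. qpoch a q n $ i = qpoch_inf a q $ i"
      using qpoch_inf_LIMSEQ[OF assms(1)] by (simp add: tendsto_fps_iff)
    then obtain n where "qpoch a q n $ i = qpoch_inf a q $ i"
      by (auto simp: eventually_sequentially)
    then show "(qpoch_inf a q - 1) $ i = 0"
      using fin[of n] \<open>i < k\<close> by (auto simp: fps_X_power_dvd_iff)
  qed
qed

subsection \<open>Solutions of the transfer recurrences\<close>

definition qi :: "'a::field fps \<Rightarrow> nat \<Rightarrow> 'a fps" where
  "qi Q n = inverse (qpoch Q Q n)"

text \<open>Triangular numbers, written as a sum so that exponents need no division by 2.\<close>

definition tri :: "nat \<Rightarrow> nat" where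
  "tri n = (\<Sum>i\<le>n. i)"

lemma tri_0 [simp]: "tri 0 = 0" and tri_Suc [simp]: "tri (Suc n) = tri n + Suc n"
  by (simp_all add: tri_def)

lemma tri_ge: "n \<le> tri n"
  by (cases n) simp_all

lemma qi_0 [simp]: "qi Q 0 = 1"
  by (simp add: qi_def)

context
  fixes Q :: "'a::field fps"
  assumes Q0: "Q $ 0 = 0"
begin

text \<open>The cancellation behind the functional equations below: if two series have terms
  differing by a factor \<open>Q ^ n\<close>, their difference carries \<open>1 - Q ^ n\<close>,
  which lowers the index of \<open>qi\<close> and shifts the series by one.\<close>

lemma qi_Suc: "(1 - Q ^ Suc n) * qi Q (Suc n) = qi Q n"
proof -
  have "(1 - Q ^ Suc n) $ 0 = 1"
    using Q0 by simp
  then have "(1 - Q ^ Suc n) * inverse (1 - Q ^ Suc n) = 1"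
    by (intro inverse_mult_eq_1') (metis zero_neq_one)
  then show ?thesis
    by (simp add: qi_def qpoch_Suc fps_inverse_mult mult_ac)
qed

lemma fps_X_power_dvd_Q: "n \<le> m \<Longrightarrow> fps_X ^ n dvd Q ^ m"
  by (meson Q0 dvd_trans fps_X_power_dvd_power le_imp_power_dvd)

text \<open>\<open>euler_tail c m\<close> satisfies the functional equation of the product
  \<open>(-c * Q^(m+1); Q)\<^sub>\<infinity>\<close>.\<close>
definition euler_tail :: "'a fps \<Rightarrow> nat \<Rightarrow> 'a fps" where
  "euler_tail c m = fps_series (\<lambda>n. c ^ n * Q ^ (tri n + m * n) * qi Q n)"

lemma rapid_euler: "rapid (\<lambda>n. c ^ n * Q ^ (tri n + m * n) * qi Q n)"
  by (intro rapidI dvd_mult dvd_mult2 fps_X_power_dvd_Q) (simp add: tri_ge trans_le_add1)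

text \<open>Raising \<open>m\<close> by one multiplies the \<open>n\<close>-th term by
  \<open>Q ^ n\<close>, so \<open>qi_Suc\<close> applies to the difference \<open>d\<close>.\<close>

lemma euler_tail_rec: "euler_tail c m = (1 + c * Q ^ Suc m) * euler_tail c (Suc m)"
proof -
  define f where "f m n = c ^ n * Q ^ (tri n + m * n) * qi Q n" for m n
  define d where "d n = f m n - f (Suc m) n" for n
  have rf: "rapid (f m)" for m
    unfolding f_def by (rule rapid_euler)
  have d0: "d 0 = 0"
    by (simp add: d_def f_def)
  have dS: "d (Suc n) = c * Q ^ Suc m * f (Suc m) n" for n
  proof -
    have "d (Suc n) = c ^ Suc n * Q ^ (tri (Suc n) + m * Suc n) * ((1 - Q ^ Suc n) * qi Q (Suc n))"
      by (simp add: d_def f_def power_add algebra_simps)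
    then show ?thesis
      unfolding qi_Suc by (simp add: f_def power_add algebra_simps)
  qed
  have rd: "rapid d"
    using rf[of m] rf[of "Suc m"] by (simp add: rapid_def d_def dvd_diff)
  have tail: "euler_tail c k = fps_series (f k)" for k
    unfolding euler_tail_def f_def ..
  have "euler_tail c m = fps_series (\<lambda>n. f (Suc m) n + d n)"
    by (simp add: tail d_def)
  also have "\<dots> = fps_series (f (Suc m)) + fps_series d"
    by (intro fps_series_add rf rd)
  also have "fps_series d = c * Q ^ Suc m * fps_series (f (Suc m))"
    by (simp only: fps_series_Suc[OF rd] d0 dS fps_series_cmult[OF rf] add_0)
  finally show ?thesis
    by (simp add: tail algebra_simps)
qed

text \<open>Euler's identity: iterating the functional equation extracts the factors of the product
  one by one, and the remaining tail tends to 1.\<close>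

lemma euler_product: "fps_series (\<lambda>n. c ^ n * Q ^ tri n * qi Q n) = qpoch_inf (- c * Q) Q"
proof -
  have eq: "euler_tail c 0 = qpoch (- c * Q) Q N * euler_tail c N" for N
  proof (induction N)
    case (Suc N)
    then show ?case
      by (simp add: qpoch_Suc euler_tail_rec[of c N] mult_ac)
  qed simp
  have "euler_tail c \<longlonglongrightarrow> 1"
  proof (rule LIMSEQ_fpsI_dvd)
    fix N
    have "euler_tail c N - 1 =
        fps_series (\<lambda>n. c ^ Suc n * Q ^ (tri (Suc n) + N * Suc n) * qi Q (Suc n))"
      unfolding euler_tail_def by (subst fps_series_Suc[OF rapid_euler]) simp
    moreover have "fps_X ^ N dvd \<dots>"
    proof (rule fps_X_power_dvd_series)
      show "fps_X ^ N dvd c ^ Suc n * Q ^ (tri (Suc n) + N * Suc n) * qi Q (Suc n)" for n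
        by (intro dvd_mult dvd_mult2 fps_X_power_dvd_Q) simp
      show "rapid (\<lambda>n. c ^ Suc n * Q ^ (tri (Suc n) + N * Suc n) * qi Q (Suc n))"
        by (intro rapidI dvd_mult dvd_mult2 fps_X_power_dvd_Q) simp
    qed
    ultimately show "fps_X ^ N dvd euler_tail c N - 1" by simp
  qed
  then have "(\<lambda>N. qpoch (- c * Q) Q N * euler_tail c N) \<longlonglongrightarrow> qpoch_inf (- c * Q) Q * 1"
    by (intro tendsto_fps_mult qpoch_inf_LIMSEQ Q0)
  moreover have "(\<lambda>N. qpoch (- c * Q) Q N * euler_tail c N) \<longlonglongrightarrow> euler_tail c 0"
    unfolding eq[symmetric] by simp
  ultimately show ?thesis
    by (auto simp: euler_tail_def dest: LIMSEQ_unique)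
qed

section \<open>One-sided words: solutions of the transfer recurrence\<close>

context
  fixes a :: "'a fps" and c :: "'a fps"
  assumes a0: "a $ 0 = 0"
begin

text \<open>The product of \<open>1 + a * Q ^ i\<close> over \<open>i \<ge> m\<close>, that is, all
  words on these sites without any weight for rises.\<close>

definition ptail :: "nat \<Rightarrow> 'a fps" where
  "ptail m = qpoch_inf (- (a * Q ^ m)) Q"

lemma ptail_rec: "ptail m = (1 + a * Q ^ m) * ptail (Suc m)"
  unfolding ptail_def by (subst qpoch_inf_rec[OF Q0]) (simp add: mult_ac)

text \<open>A rise of weight \<open>1 + c\<close> is either unmarked or marked with weight
  \<open>c\<close>; the index \<open>n\<close> counts the marked rises.\<close>

definition v_term :: "nat \<Rightarrow> nat \<Rightarrow> 'a fps" where
  "v_term m n = c ^ n * a ^ n * Q ^ (n * m + n * (n - 1)) * ptail (m + n) * qi Q n"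

definition w_term :: "nat \<Rightarrow> nat \<Rightarrow> 'a fps" where
  "w_term m n = c ^ n * a ^ n * Q ^ (n * m + n * n) * ptail (m + n) * qi Q n"

text \<open>The generating functions of the words on the sites \<open>m, m + 1, \<dots>\<close>, where site \<open>i\<close> has
  weight \<open>a * Q^i\<close> when occupied and each rise has weight \<open>1 + c\<close>; the site preceding \<open>m\<close> is
  empty for \<open>vsol\<close> and occupied for \<open>wsol\<close>.\<close>
definition vsol :: "nat \<Rightarrow> 'a fps" where "vsol m = fps_series (v_term m)"
definition wsol :: "nat \<Rightarrow> 'a fps" where "wsol m = fps_series (w_term m)"

lemma fps_X_power_dvd_a: "fps_X ^ n dvd a ^ n"
  by (rule fps_X_power_dvd_power[OF a0])

lemma rapid_v: "rapid (v_term m)" and rapid_w: "rapid (w_term m)"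
  unfolding v_term_def w_term_def
  by (intro rapidI dvd_mult2 dvd_mult fps_X_power_dvd_a)+

text \<open>The \<open>n\<close>-th term of \<open>wsol m\<close> is \<open>Q ^ n\<close> times that
  of \<open>vsol m\<close>, so the difference shifts by \<open>qi_Suc\<close>.\<close>

lemma vsol_eq_wsol: "vsol m = wsol m + c * (a * Q ^ m) * wsol (Suc m)"
proof -
  define d where "d n = v_term m n - w_term m n" for n
  have d0: "d 0 = 0"
    by (simp add: d_def v_term_def w_term_def)
  have dS: "d (Suc n) = c * (a * Q ^ m) * w_term (Suc m) n" for n
  proof -
    have "d (Suc n) = c ^ Suc n * a ^ Suc n * Q ^ (Suc n * m + Suc n * n) * ptail (m + Suc n)
        * ((1 - Q ^ Suc n) * qi Q (Suc n))"
      by (simp add: d_def v_term_def w_term_def power_add algebra_simps)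
    then show ?thesis
      unfolding qi_Suc by (simp add: w_term_def power_add algebra_simps)
  qed
  have rd: "rapid d"
    using rapid_v[of m] rapid_w[of m] by (simp add: rapid_def d_def dvd_diff)
  have "vsol m = fps_series (\<lambda>n. w_term m n + d n)"
    by (simp add: vsol_def d_def)
  also have "\<dots> = wsol m + fps_series d"
    unfolding wsol_def by (intro fps_series_add rapid_w rd)
  also have "fps_series d = c * (a * Q ^ m) * wsol (Suc m)"
    by (simp only: wsol_def fps_series_Suc[OF rd] d0 dS fps_series_cmult[OF rapid_w] add_0)
  finally show ?thesis .
qed

text \<open>Site \<open>m\<close> is empty or occupied, and after an occupied site neither choice
  makes a rise. In the series this is the splitting of the first factor off
  \<open>ptail (m + n)\<close>.\<close>

lemma wsol_rec: "wsol m = vsol (Suc m) + a * Q ^ m * wsol (Suc m)"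
proof -
  have 1: "w_term m n = v_term (Suc m) n + a * Q ^ m * w_term (Suc m) n" for n
  proof -
    have "w_term m n = c ^ n * a ^ n * Q ^ (n * m + n * n) * ((1 + a * Q ^ (m + n)) * ptail (Suc m + n)) * qi Q n"
      unfolding w_term_def by (subst ptail_rec) simp
    moreover have "n * Suc m + n * (n - 1) = n * m + n * n"
      by (cases n) simp_all
    ultimately show ?thesis
      by (simp add: v_term_def w_term_def power_add algebra_simps)
  qed
  have r: "rapid (\<lambda>n. a * Q ^ m * w_term (Suc m) n)"
    using rapid_w[of "Suc m"] by (simp add: rapid_def)
  have "wsol m = fps_series (\<lambda>n. v_term (Suc m) n + a * Q ^ m * w_term (Suc m) n)"
    unfolding wsol_def using 1 by presburger
  also have "\<dots> = vsol (Suc m) + a * Q ^ m * wsol (Suc m)"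
    unfolding vsol_def wsol_def
    by (simp only: fps_series_add[OF rapid_v r] fps_series_cmult[OF rapid_w])
  finally show ?thesis .
qed

lemma vsol_rec: "vsol m = vsol (Suc m) + (1 + c) * (a * Q ^ m) * wsol (Suc m)"
  by (subst vsol_eq_wsol, subst wsol_rec) (simp add: algebra_simps)

text \<open>The normalisation at infinity: all terms with positive index contain
  \<open>Q ^ m\<close>, and \<open>ptail m\<close> is close to 1.\<close>

lemma fps_X_power_dvd_vsol: "fps_X ^ m dvd vsol m - 1"
  and fps_X_power_dvd_wsol: "fps_X ^ m dvd wsol m - 1"
proof -
  have pt: "fps_X ^ m dvd ptail m - 1"
    unfolding ptail_def by (intro fps_X_power_dvd_qpoch_inf Q0) (simp add: fps_X_power_dvd_Q)
  have "fps_X ^ m dvd fps_series (\<lambda>n. w_term m (Suc n))"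
    by (rule fps_X_power_dvd_series, (rule rapidI)?; unfold w_term_def;
        intro dvd_mult dvd_mult2 fps_X_power_dvd_Q) simp_all
  then have "fps_X ^ m dvd (ptail m - 1) + fps_series (\<lambda>n. w_term m (Suc n))"
    using pt by (rule dvd_add[rotated])
  then show w: "fps_X ^ m dvd wsol m - 1"
    unfolding wsol_def fps_series_Suc[OF rapid_w] by (simp add: w_term_def algebra_simps)
  have "fps_X ^ m dvd Q ^ m * (c * a * wsol (Suc m))"
    by (intro dvd_mult2 fps_X_power_dvd_Q) simp
  then have "fps_X ^ m dvd (wsol m - 1) + Q ^ m * (c * a * wsol (Suc m))"
    using w by (rule dvd_add[rotated])
  then show "fps_X ^ m dvd vsol m - 1"
    by (simp add: vsol_eq_wsol[of m] algebra_simps)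
qed

text \<open>Finite words are glued to their infinite continuations. The total does not depend on the
  place \<open>N\<close> of the cut, and far out the continuations are close to 1.\<close>

lemma transfer_approx:
  fixes Z Y :: "nat \<Rightarrow> 'a fps"
  assumes Z: "\<And>N. Z (Suc N) = Z N + a * Q ^ N * Y N"
    and Y: "\<And>N. Y (Suc N) = (1 + c) * Z N + a * Q ^ N * Y N"
  shows "fps_X ^ N dvd Z N - (Z 0 * vsol 1 + Y 0 * a * wsol 1)"
proof -
  \<comment> \<open>Site \<open>N\<close> is the cut: empty with continuation
    \<open>vsol (Suc N)\<close>, or occupied with weight \<open>a * Q ^ N\<close> and continuation
    \<open>wsol (Suc N)\<close>.\<close>
  have inv: "Z N * vsol (Suc N) + a * Q ^ N * Y N * wsol (Suc N) = Z 0 * vsol 1 + Y 0 * a * wsol 1"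
  proof (induction N)
    case (Suc N)
    show ?case
      unfolding Suc.IH[symmetric] Z Y vsol_rec[of "Suc N"] wsol_rec[of "Suc N"]
      by (simp add: algebra_simps)
  qed simp
  have "fps_X ^ N dvd vsol (Suc N) - 1"
    using fps_X_power_dvd_vsol[of "Suc N"] by (meson dvd_trans le_imp_power_dvd le_SucI order_refl)
  then have "fps_X ^ N dvd - (Z N * (vsol (Suc N) - 1) + Q ^ N * (a * Y N * wsol (Suc N)))"
    by (intro dvd_minus_iff[THEN iffD2] dvd_add dvd_mult[of _ "vsol (Suc N) - 1"]
        dvd_mult2[of _ "Q ^ N"] fps_X_power_dvd_Q order_refl)
  then show ?thesis
    unfolding inv[symmetric] by (simp add: algebra_simps)
qed

end

section \<open>Two-sided words: extension to the left and its limit\<close>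

context
  fixes a b c :: "'a fps"
  assumes a0: "a $ 0 = 0" and ab: "a * b = Q"
begin

text \<open>Extending the words by \<open>N\<close> sites to the left, of weights \<open>b * Q^j\<close> when empty, amounts to
  replacing \<open>a\<close> by \<open>a / Q^N\<close> in the series for \<open>vsol 0\<close> and clearing denominators.
  The terms are \<open>bi_term N\<close>.\<close>
fun bi_term :: "nat \<Rightarrow> nat \<Rightarrow> 'a fps" where
  "bi_term 0 n = a ^ n * Q ^ (n * (n - 1)) * ptail a n"
| "bi_term (Suc N) 0 = ptail a 0 * qpoch (- b) Q (Suc N)"
| "bi_term (Suc N) (Suc n) = Q ^ n * bi_term N n"

lemma bi_term_0: "bi_term N 0 = ptail a 0 * qpoch (- b) Q N"
  by (cases N) simp_all

text \<open>For \<open>N = 0\<close> the factor \<open>Q * (1 + a * Q ^ k)\<close>, with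
  \<open>Q = a * b\<close>, splits into the two summands; the shift in the definition of
  \<open>bi_term\<close> carries this to larger \<open>N\<close>.\<close>

lemma bi_term_rec: "Q ^ n * bi_term (Suc N) n = b * Q ^ N * bi_term N n + Q ^ n * bi_term N n"
proof (induction N n rule: bi_term.induct)
  case (1 n)
  show ?case
  proof (cases n)
    case 0
    then show ?thesis
      by (simp add: qpoch_Suc algebra_simps)
  next
    case (Suc k)
    have e: "k * k - k + k = k * k"
      by (metis le_add_diff_inverse2 le_square)
    have "Q ^ n * bi_term (Suc 0) n = Q * Q ^ k * Q ^ k * Q ^ (k * (k - 1)) * a ^ k * ((1 + a * Q ^ k) * ptail a (Suc k))"
      unfolding ptail_rec[OF a0, symmetric] by (simp add: Suc mult_ac)
    also have "Q * Q ^ k * Q ^ k * Q ^ (k * (k - 1)) = Q * Q ^ k * Q ^ (k * k)"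
      using e by (simp add: power_add[symmetric] diff_mult_distrib2 add.commute)
    also have "Q * Q ^ k * Q ^ (k * k) * a ^ k * ((1 + a * Q ^ k) * ptail a (Suc k))
        = (a * b + a * Q ^ Suc k) * Q ^ k * Q ^ (k * k) * a ^ k * ptail a (Suc k)"
      by (simp add: ab algebra_simps)
    also have "\<dots> = b * Q ^ 0 * bi_term 0 n + Q ^ n * bi_term 0 n"
      by (simp add: Suc power_add algebra_simps)
    finally show ?thesis .
  qed
next
  case (2 N)
  show ?case by (simp add: qpoch_Suc algebra_simps)
next
  case (3 N n)
  have "Q ^ Suc n * bi_term (Suc (Suc N)) (Suc n) = Q ^ Suc n * (Q ^ n * bi_term (Suc N) n)"
    by simp
  also have "\<dots> = Q ^ Suc n * (b * Q ^ N * bi_term N n + Q ^ n * bi_term N n)"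
    by (simp only: 3)
  finally show ?case
    by (simp add: algebra_simps)
qed

text \<open>The site just left of the \<open>N\<close> added ones is occupied for \<open>zbi\<close>
  and empty for \<open>ybi\<close>.\<close>

definition zbi :: "nat \<Rightarrow> 'a fps" where
  "zbi N = fps_series (\<lambda>n. c ^ n * (Q ^ n * bi_term N n) * qi Q n)"

definition ybi :: "nat \<Rightarrow> 'a fps" where
  "ybi N = fps_series (\<lambda>n. c ^ n * bi_term N n * qi Q n)"

lemma rapid_z: "rapid (\<lambda>n. c ^ n * (Q ^ n * bi_term N n) * qi Q n)"
  by (intro rapidI dvd_mult2 dvd_mult fps_X_power_dvd_Q) simp

lemma fps_X_power_dvd_bi_term: "fps_X ^ n dvd bi_term N (Suc n)"
proof (cases N)
  case 0
  have "fps_X ^ n dvd a ^ Suc n"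
    by (rule dvd_trans[OF le_imp_power_dvd fps_X_power_dvd_a[OF a0]]) simp
  then show ?thesis
    unfolding 0 bi_term.simps by (intro dvd_mult2)
next
  case (Suc M)
  then show ?thesis by (auto intro: dvd_mult2 fps_X_power_dvd_Q)
qed

lemma rapid_y: "rapid (\<lambda>n. c ^ n * bi_term N n * qi Q n)"
  unfolding rapid_def by (intro allI dvd_mult2 dvd_mult fps_X_power_dvd_bi_term)

lemma zbi_0: "zbi 0 = wsol a c 0"
proof -
  have "c ^ n * (Q ^ n * bi_term 0 n) * qi Q n = w_term a c 0 n" for n
    by (cases n) (simp_all add: w_term_def[OF a0] power_add algebra_simps)
  then show ?thesis by (simp add: zbi_def wsol_def[OF a0])
qed

lemma ybi_0: "ybi 0 = vsol a c 0"
proof -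
  have "c ^ n * bi_term 0 n * qi Q n = v_term a c 0 n" for n
    by (simp add: v_term_def[OF a0] mult_ac)
  then show ?thesis by (simp add: ybi_def vsol_def[OF a0])
qed

lemma zbi_Suc: "zbi (Suc N) = zbi N + b * Q ^ N * ybi N"
proof -
  have r: "rapid (\<lambda>n. b * Q ^ N * (c ^ n * bi_term N n * qi Q n))"
    using rapid_y[of N] by (simp add: rapid_def)
  have "c ^ n * (Q ^ n * bi_term (Suc N) n) * qi Q n =
      c ^ n * (Q ^ n * bi_term N n) * qi Q n + b * Q ^ N * (c ^ n * bi_term N n * qi Q n)" for n
    by (simp only: bi_term_rec) (simp add: algebra_simps)
  then show ?thesis
    by (simp only: zbi_def ybi_def fps_series_add[OF rapid_z r] fps_series_cmult[OF rapid_y])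
qed

text \<open>The series of \<open>ybi (Suc N)\<close> and \<open>zbi (Suc N)\<close> differ by the
  factor \<open>Q ^ n\<close> in their terms; after the shift by \<open>qi_Suc\<close>, the last
  equation of \<open>bi_term\<close> leaves \<open>c * zbi N\<close>.\<close>

lemma ybi_Suc: "ybi (Suc N) = (1 + c) * zbi N + b * Q ^ N * ybi N"
proof -
  define f where "f n = c ^ n * (Q ^ n * bi_term (Suc N) n) * qi Q n" for n
  define d where "d n = c ^ n * bi_term (Suc N) n * qi Q n - f n" for n
  have rf: "rapid f"
    unfolding f_def by (rule rapid_z)
  have d0: "d 0 = 0"
    by (simp add: d_def f_def)
  have dS: "d (Suc n) = c * (c ^ n * (Q ^ n * bi_term N n) * qi Q n)" for n
  proof -
    have "d (Suc n) = c ^ Suc n * bi_term (Suc N) (Suc n) * ((1 - Q ^ Suc n) * qi Q (Suc n))"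
      by (simp add: d_def f_def algebra_simps)
    then show ?thesis
      unfolding qi_Suc by (simp add: algebra_simps)
  qed
  have rd: "rapid d"
    using rf rapid_y[of "Suc N"] by (simp add: rapid_def d_def dvd_diff)
  have "ybi (Suc N) = fps_series (\<lambda>n. f n + d n)"
    by (simp add: ybi_def d_def)
  also have "\<dots> = zbi (Suc N) + fps_series d"
    unfolding zbi_def f_def[symmetric] by (intro fps_series_add rf rd)
  also have "fps_series d = c * zbi N"
    by (simp only: fps_series_Suc[OF rd] d0 dS fps_series_cmult[OF rapid_z] zbi_def add_0)
  finally show ?thesis
    by (simp add: zbi_Suc algebra_simps)
qed

text \<open>Unfolding \<open>n\<close> shifts collects the exponents
  \<open>n, n - 1, \<dots>, 0\<close> into \<open>tri n\<close> and leaves only the product part,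
  whose limit is known.\<close>

lemma bi_term_add: "Q ^ n * bi_term (k + n) n = Q ^ tri n * (ptail a 0 * qpoch (- b) Q k)"
  by (induction n) (simp_all add: bi_term_0 power_add mult_ac)

text \<open>In the termwise limit the two products \<open>P\<close> no longer depend on
  \<open>n\<close>, and what remains is the series of \<open>euler_product\<close>.\<close>

lemma zbi_tendsto: "zbi \<longlonglongrightarrow> qpoch_inf (- a) Q * qpoch_inf (- b) Q * qpoch_inf (- c * Q) Q"
proof -
  define P where "P = qpoch_inf (- a) Q * qpoch_inf (- b) Q"
  have lim: "(\<lambda>N. c ^ n * (Q ^ n * bi_term N n) * qi Q n) \<longlonglongrightarrow> P * (c ^ n * Q ^ tri n * qi Q n)" for n
  proof (rule LIMSEQ_offset[where k = n])
    have "(\<lambda>k. c ^ n * (Q ^ tri n * (ptail a 0 * qpoch (- b) Q k)) * qi Q n) \<longlonglongrightarrow>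
        c ^ n * (Q ^ tri n * (ptail a 0 * qpoch_inf (- b) Q)) * qi Q n"
      by (intro tendsto_intros qpoch_inf_LIMSEQ Q0)
    then show "(\<lambda>k. c ^ n * (Q ^ n * bi_term (k + n) n) * qi Q n) \<longlonglongrightarrow> P * (c ^ n * Q ^ tri n * qi Q n)"
      unfolding bi_term_add by (simp add: P_def ptail_def[OF a0] mult_ac)
  qed
  have re: "rapid (\<lambda>n. c ^ n * Q ^ tri n * qi Q n)"
    using rapid_euler[of c 0] by simp
  have "zbi \<longlonglongrightarrow> fps_series (\<lambda>n. P * (c ^ n * Q ^ tri n * qi Q n))"
    unfolding zbi_def
    by (rule tendsto_fps_series[OF rapid_z _ lim]) (use re in \<open>simp add: rapid_def\<close>)
  then show ?thesis
    by (simp only: fps_series_cmult[OF re] euler_product P_def)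
qed

end

end

subsection \<open>Self-conjugate partitions and sets of principal hooks\<close>

text \<open>Padding by 0 makes rows available at every index, so that self-conjugacy becomes a
  symmetric relation without range conditions.\<close>

definition row :: "nat list \<Rightarrow> nat \<Rightarrow> nat" where
  "row lam i = (if i < length lam then lam ! i else 0)"

lemma row_antimono:
  assumes "is_partition lam" "i \<le> k"
  shows "row lam k \<le> row lam i"
proof (cases "i = k")
  case False
  with assms show ?thesis
    by (auto simp: is_partition_def row_def sorted_wrt_iff_nth_less)
qed simp

lemma row_eq_0_iff: "is_partition lam \<Longrightarrow> row lam i = 0 \<longleftrightarrow> length lam \<le> i"
  by (auto simp: is_partition_def row_def)

lemma mem_cells_iff: "(i, j) \<in> cells lam \<longleftrightarrow> j < row lam i"
  by (simp add: cells_def row_def)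

lemma card_cells: "card (cells lam) = psize lam"
proof -
  have "cells lam = Sigma {..<length lam} (\<lambda>i. {..<lam ! i})"
    by (auto simp: cells_def)
  then show ?thesis
    by (simp add: psize_def sum_list_sum_nth atLeast0LessThan)
qed

lemma column_eq:
  assumes "is_partition lam"
  shows "{i. i < length lam \<and> j < lam ! i} = {..<card {i. i < length lam \<and> j < lam ! i}}"
proof -
  let ?A = "{i. i < length lam \<and> j < lam ! i}"
  have A: "?A = {i. j < row lam i}"
    by (auto simp: row_def)
  have "\<exists>k. {i. j < row lam i} = {..<k}"
  proof -
    have ex: "\<exists>k. row lam k \<le> j"
      by (rule exI[of _ "length lam"]) (simp add: row_def)
    define k where "k = (LEAST k. row lam k \<le> j)"
    have k: "row lam k \<le> j"
      unfolding k_def using ex by (rule LeastI_ex)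
    have "j < row lam i \<longleftrightarrow> i < k" for i
    proof
      assume "j < row lam i"
      then show "i < k"
        using k row_antimono[OF assms, of k i] by (metis leI le_trans not_le)
    next
      assume "i < k"
      then show "j < row lam i"
        unfolding k_def using not_less_Least[of i "\<lambda>k. row lam k \<le> j"] by simp
    qed
    then show ?thesis by auto
  qed
  then obtain k where "{i. j < row lam i} = {..<k}" ..
  then show ?thesis unfolding A by simp
qed

text \<open>Self-conjugacy as symmetry of the diagram under exchange of coordinates; the first row
  then has as many cells as there are rows.\<close>

lemma self_conjugate_iff:
  assumes p: "is_partition lam"
  shows "self_conjugate lam \<longleftrightarrow> (\<forall>i j. j < row lam i \<longleftrightarrow> i < row lam j)"
proof
  assume sc: "self_conjugate lam"
  then have "length lam = length (conjugate lam)"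
    by (simp add: self_conjugate_def)
  then have hd: "lam \<noteq> [] \<Longrightarrow> hd lam = length lam"
    by (simp add: conjugate_def)
  have *: "i < row lam j" if "j < row lam i" for i j
  proof -
    have i: "i < length lam" "j < lam ! i" using that by (auto simp: row_def split: if_splits)
    then have ne: "lam \<noteq> []" by auto
    have "j < row lam 0" using that row_antimono[OF p, of 0 i] by simp
    then have j: "j < length lam"
      using ne hd by (simp add: row_def hd_conv_nth)
    have "lam ! j = conjugate lam ! j" using sc by (simp add: self_conjugate_def)
    also have "\<dots> = card {i. i < length lam \<and> j < lam ! i}"
      using j ne hd by (simp add: conjugate_def)
    finally have "{i. i < length lam \<and> j < lam ! i} = {..<lam ! j}"
      using column_eq[OF p, of j] by simp
    then show ?thesis using i j by (auto simp: row_def)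
  qed
  then show "\<forall>i j. j < row lam i \<longleftrightarrow> i < row lam j" by blast
next
  assume sym: "\<forall>i j. j < row lam i \<longleftrightarrow> i < row lam j"
  show "self_conjugate lam"
  proof (cases "lam = []")
    case False
    have "j < length lam \<longleftrightarrow> j < row lam 0" for j
      using sym row_eq_0_iff[OF p, of j] by (metis gr_zeroI not_le not_less_zero)
    then have hd: "row lam 0 = length lam"
      by (metis less_irrefl nat_neq_iff)
    then have hd': "hd lam = length lam"
      using False by (simp add: row_def hd_conv_nth)
    have "conjugate lam ! j = lam ! j" if "j < length lam" for j
    proof -
      have "{i. i < length lam \<and> j < lam ! i} = {i. j < row lam i}"
        by (auto simp: row_def)
      also have "\<dots> = {..<row lam j}" using sym by auto
      finally show ?thesis using that hd' by (simp add: conjugate_def row_def)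
    qed
    then show ?thesis
      unfolding self_conjugate_def using hd' False
      by (intro nth_equalityI) (simp_all add: conjugate_def)
  qed (simp add: self_conjugate_def conjugate_def)
qed

lemma SC_iff: "lam \<in> SC \<longleftrightarrow> is_partition lam \<and> (\<forall>i j. j < row lam i \<longleftrightarrow> i < row lam j)"
  unfolding SC_def mem_Collect_eq using self_conjugate_iff by blast

lemma row_inject:
  assumes "is_partition lam" "is_partition mu" "row lam = row mu"
  shows "lam = mu"
proof (rule nth_equalityI)
  have "length lam \<le> i \<longleftrightarrow> length mu \<le> i" for i
    using row_eq_0_iff[OF assms(1), of i] row_eq_0_iff[OF assms(2), of i] assms(3) by simp
  then show len: "length lam = length mu"
    by (metis le_antisym order_refl)
  fix i assume "i < length lam"
  then show "lam ! i = mu ! i"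
    using fun_cong[OF assms(3), of i] len by (simp add: row_def)
qed

text \<open>The \<open>beta\<close> numbers of a partition: the up-steps of its boundary path.
  The principal hook in row \<open>i\<close> of a self-conjugate partition has length \<open>2 * beta lam i + 1\<close>.\<close>
definition beta :: "nat list \<Rightarrow> nat \<Rightarrow> int" where
  "beta lam i = int (row lam i) - int i - 1"

text \<open>Only the nonnegative beta numbers are kept; by \<open>beta_reflect\<close> they
  determine the negative ones.\<close>

definition diag :: "nat list \<Rightarrow> nat set" where
  "diag lam = {d. int d \<in> range (beta lam)}"

lemma mem_diag_iff: "d \<in> diag lam \<longleftrightarrow> (\<exists>i. row lam i = d + i + 1)"
proof -
  have "int d = beta lam i \<longleftrightarrow> row lam i = d + i + 1" for i
    unfolding beta_def by linarith
  then show ?thesis by (auto simp: diag_def image_iff)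
qed

lemma beta_strict_anti: "is_partition lam \<Longrightarrow> i < k \<Longrightarrow> beta lam k < beta lam i"
  using row_antimono[of lam i k] by (simp add: beta_def)

lemma beta_inject: "is_partition lam \<Longrightarrow> beta lam i = beta lam k \<longleftrightarrow> i = k"
  by (metis beta_strict_anti less_irrefl nat_neq_iff)

text \<open>Reflection in the diagonal exchanges the two kinds of boundary steps. If
  \<open>s\<close> and \<open>- 1 - s\<close> both occurred, at rows \<open>i\<close> and
  \<open>j\<close>, then \<open>row lam i + row lam j = i + j + 1\<close>, which symmetry
  excludes.\<close>

lemma beta_reflect:
  assumes "lam \<in> SC"
  shows "- 1 - s \<in> range (beta lam) \<longleftrightarrow> s \<notin> range (beta lam)"
proof -
  have p: "is_partition lam" and sym: "j < row lam i \<longleftrightarrow> i < row lam j" for i j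
    using assms by (auto simp: SC_iff)
  show ?thesis
  proof
    assume "- 1 - s \<in> range (beta lam)"
    then obtain j where "- 1 - s = beta lam j"
      by auto
    then have j: "s = int j - int (row lam j)"
      by (simp add: beta_def)
    show "s \<notin> range (beta lam)"
    proof
      assume "s \<in> range (beta lam)"
      then obtain i where i: "s = int (row lam i) - int i - 1"
        by (auto simp: beta_def)
      show False using sym[of j i] i j by linarith
    qed
  next
    assume s: "s \<notin> range (beta lam)"
    \<comment> \<open>There are exactly \<open>i\<close> beta numbers above \<open>s\<close>. As
      \<open>s\<close> itself is missed, column \<open>s + i\<close> has length \<open>i\<close>,
      and by symmetry so does that row, which yields the beta number \<open>- 1 - s\<close>.\<close>
    define i where "i = (LEAST i. beta lam i < s)"
    have "beta lam (length lam + nat \<bar>s\<bar>) < s"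
      by (simp add: beta_def row_def)
    then have i: "beta lam i < s"
      unfolding i_def by (rule LeastI)
    have less: "beta lam k > s" if "k < i" for k
      using not_less_Least[of k "\<lambda>i. beta lam i < s"] that s unfolding i_def
      by (metis not_less_iff_gr_or_eq rangeI)
    define j where "j = nat (s + int i)"
    have j: "int j = s + int i"
      using i by (simp add: j_def beta_def)
    have "k < row lam j \<longleftrightarrow> k < i" for k
    proof -
      have "j < row lam k \<longleftrightarrow> k < i"
      proof
        assume "k < i"
        then have "row lam (i - 1) \<le> row lam k"
          by (intro row_antimono[OF p]) simp
        moreover have "beta lam (i - 1) > s"
          using \<open>k < i\<close> by (intro less) simp
        ultimately show "j < row lam k"
          using j \<open>k < i\<close> by (simp add: beta_def of_nat_diff)
      next
        assume *: "j < row lam k"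
        show "k < i"
        proof (rule ccontr)
          assume "\<not> k < i"
          then have "row lam k \<le> row lam i"
            by (intro row_antimono[OF p]) simp
          with * i j show False by (simp add: beta_def)
        qed
      qed
      then show ?thesis using sym[of j k] by simp
    qed
    then have "row lam j = i"
      by (metis less_irrefl nat_neq_iff)
    then have "beta lam j = - 1 - s"
      using j by (simp add: beta_def)
    then show "- 1 - s \<in> range (beta lam)"
      by (metis rangeI)
  qed
qed

lemma mem_range_beta_iff:
  assumes "lam \<in> SC"
  shows "s \<in> range (beta lam) \<longleftrightarrow> (if 0 \<le> s then nat s \<in> diag lam else nat (- 1 - s) \<notin> diag lam)"
proof (cases "0 \<le> s")
  case False
  then have "nat (- 1 - s) \<in> diag lam \<longleftrightarrow> s \<notin> range (beta lam)"
    unfolding diag_def using beta_reflect[OF assms, of s] by simp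
  with False show ?thesis by simp
qed (simp add: diag_def)

text \<open>By strong induction: \<open>f i\<close> equals some \<open>g k\<close>, and
  \<open>k < i\<close> would give \<open>f k = f i\<close>. Hence \<open>f i \<le> g i\<close>, and
  the same holds with \<open>f\<close> and \<open>g\<close> exchanged.\<close>

lemma strict_antimono_range_unique:
  fixes f g :: "nat \<Rightarrow> int"
  assumes f: "\<And>i k. i < k \<Longrightarrow> f k < f i" and g: "\<And>i k. i < k \<Longrightarrow> g k < g i"
    and eq: "range f = range g"
  shows "f = g"
proof
  have aux: "f' i \<le> g' i"
    if f': "\<And>i k. i < k \<Longrightarrow> f' k < f' i" and g': "\<And>i k. i < k \<Longrightarrow> g' k < g' i"
      and eq': "range f' = range g'" and IH: "\<And>k. k < i \<Longrightarrow> f' k = g' k"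
    for f' g' :: "nat \<Rightarrow> int" and i
  proof -
    obtain k where k: "f' i = g' k" using eq' by blast
    have "\<not> k < i"
      using IH[of k] f'[of k i] k by auto
    then show ?thesis
      using k g'[of i k] by (cases "i = k") auto
  qed
  fix i
  show "f i = g i"
  proof (induction i rule: less_induct)
    case (less i)
    then show ?case
      using aux[of f g i] aux[of g f i] f g eq by (metis antisym)
  qed
qed

lemma diag_inj: "inj_on diag SC"
proof (rule inj_onI)
  fix lam mu assume *: "lam \<in> SC" "mu \<in> SC" "diag lam = diag mu"
  have p: "is_partition lam" "is_partition mu"
    using * by (auto simp: SC_def)
  have "range (beta lam) = range (beta mu)"
    unfolding set_eq_iff mem_range_beta_iff[OF *(1)] mem_range_beta_iff[OF *(2)] *(3) by simp
  then have "beta lam = beta mu"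
    using p by (intro strict_antimono_range_unique) (auto intro: beta_strict_anti)
  then have "row lam = row mu"
    by (auto simp: beta_def fun_eq_iff)
  then show "lam = mu"
    using p by (rule row_inject[rotated 2])
qed

text \<open>Induction over the elements in increasing order: a new maximum \<open>d\<close> becomes
  an outermost principal hook of length \<open>2 * d + 1\<close> wrapped around the diagram built so
  far.\<close>

lemma diag_surj:
  assumes "finite D"
  shows "\<exists>lam\<in>SC. diag lam = D"
  using assms
proof (induction D rule: finite_linorder_max_induct)
  case empty
  have "[] \<in> SC" by (simp add: SC_iff is_partition_def row_def)
  moreover have "diag [] = {}" by (auto simp: mem_diag_iff row_def)
  ultimately show ?case by blast
next
  case (insert d D)
  then obtain lam where lam: "lam \<in> SC" "diag lam = D" by blast
  then have p: "is_partition lam" and sym: "\<And>i j. j < row lam i \<longleftrightarrow> i < row lam j"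
    by (auto simp: SC_iff)
  have top: "row lam 0 \<le> d"
  proof (cases "row lam 0")
    case (Suc e)
    then have "e \<in> diag lam" unfolding mem_diag_iff by (intro exI[of _ 0]) simp
    then show ?thesis using insert lam Suc by auto
  qed simp
  have bound: "k < d" if "0 < row lam k" for k
    using that sym[of 0 k] top by simp
  \<comment> \<open>A first row of \<open>d + 1\<close> cells and a first column of the same height;
    \<open>top\<close> and \<open>bound\<close> say that the old diagram fits inside.\<close>
  define mu where "mu = Suc d # map (\<lambda>k. Suc (row lam k)) [0..<d]"
  have row0: "row mu 0 = Suc d"
    by (simp add: mu_def row_def)
  have rowS: "row mu (Suc k) = (if k < d then Suc (row lam k) else 0)" for k
    by (simp add: mu_def row_def)
  have "is_partition mu"
    unfolding is_partition_def
  proof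
    have "Suc (row lam k) \<le> Suc d" for k
      using row_antimono[OF p, of 0 k] top by simp
    moreover have "sorted_wrt (\<ge>) (map (\<lambda>k. Suc (row lam k)) [0..<d])"
      by (auto simp: sorted_wrt_iff_nth_less intro!: row_antimono[OF p])
    ultimately show "sorted_wrt (\<ge>) mu"
      by (auto simp: mu_def)
  qed (auto simp: mu_def)
  moreover have "j < row mu i \<longleftrightarrow> i < row mu j" for i j
  proof -
    have "k < d \<and> l < row lam k \<longleftrightarrow> l < d \<and> k < row lam l" for k l
      using sym[of l k] bound[of k] bound[of l] by auto
    then show ?thesis
      by (cases i; cases j) (auto simp: row0 rowS)
  qed
  ultimately have "mu \<in> SC" by (simp add: SC_iff)
  moreover have "diag mu = insert d D"
  proof (intro set_eqI)
    fix e
    have "e \<in> diag mu \<longleftrightarrow> row mu 0 = Suc e \<or> (\<exists>k. row mu (Suc k) = e + Suc k + 1)"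
      unfolding mem_diag_iff by (metis Suc_eq_plus1 add.commute add_0 not0_implies_Suc)
    also have "(\<exists>k. row mu (Suc k) = e + Suc k + 1) \<longleftrightarrow> e \<in> diag lam"
      unfolding mem_diag_iff using bound by (intro iff_exI) (auto simp: rowS)
    finally show "e \<in> diag mu \<longleftrightarrow> e \<in> insert d D"
      using lam by (auto simp: row0)
  qed
  ultimately show ?case by blast
qed

lemma diag_bij: "bij_betw diag SC {D. finite D}"
proof -
  have "finite (diag lam)" if "lam \<in> SC" for lam
  proof (rule finite_subset)
    show "diag lam \<subseteq> {..row lam 0}"
    proof
      fix d assume "d \<in> diag lam"
      then obtain i where "row lam i = d + i + 1"
        by (auto simp: mem_diag_iff)
      moreover have "row lam i \<le> row lam 0"
        using that by (intro row_antimono) (auto simp: SC_def)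
      ultimately show "d \<in> {..row lam 0}" by simp
    qed
  qed simp
  then have "diag ` SC = {D. finite D}"
    using diag_surj by (auto simp: image_iff)
  then show ?thesis by (simp add: bij_betw_def diag_inj)
qed

text \<open>The diagram is the disjoint union of its principal hooks \<open>hk k\<close>, one for
  each diagonal cell.\<close>

lemma psize_SC:
  assumes "lam \<in> SC"
  shows "psize lam = (\<Sum>d\<in>diag lam. 2 * d + 1)"
proof -
  have p: "is_partition lam" and sym: "\<And>i j. j < row lam i \<longleftrightarrow> i < row lam j"
    using assms by (auto simp: SC_iff)
  define I where "I = {k. k < row lam k}"
  define hk where "hk k = {k} \<times> {k..<row lam k} \<union> {k<..<row lam k} \<times> {k}" for k
  have "I \<subseteq> {..<length lam}"
    by (auto simp: I_def row_def split: if_splits)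
  then have finI: "finite I" by (rule finite_subset) simp
  have "cells lam = (\<Union>k\<in>I. hk k)"
  proof (intro set_eqI, safe)
    fix i j assume "(i, j) \<in> cells lam"
    then have ij: "j < row lam i" "i < row lam j"
      using sym by (auto simp: mem_cells_iff)
    show "(i, j) \<in> (\<Union>k\<in>I. hk k)"
    proof (cases "i \<le> j")
      case True
      then show ?thesis using ij by (intro UN_I[of i]) (auto simp: I_def hk_def)
    next
      case False
      then show ?thesis using ij by (intro UN_I[of j]) (auto simp: I_def hk_def)
    qed
  next
    fix i j k assume "(i, j) \<in> hk k"
    then show "(i, j) \<in> cells lam"
      using sym by (auto simp: hk_def mem_cells_iff)
  qed
  then have "psize lam = card (\<Union>k\<in>I. hk k)"
    by (simp add: card_cells[symmetric])
  also have "\<dots> = (\<Sum>k\<in>I. card (hk k))"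
    by (rule card_UN_disjoint) (auto simp: finI hk_def)
  also have "\<dots> = (\<Sum>k\<in>I. 2 * (row lam k - k - 1) + 1)"
  proof (rule sum.cong)
    fix k assume "k \<in> I"
    then have "k < row lam k" by (simp add: I_def)
    have "card (hk k) = card ({k} \<times> {k..<row lam k}) + card ({k<..<row lam k} \<times> {k})"
      unfolding hk_def by (rule card_Un_disjoint) auto
    also have "\<dots> = (row lam k - k) + (row lam k - Suc k)"
      by (simp only: card_cartesian_product card_atLeastLessThan card_greaterThanLessThan) simp
    finally show "card (hk k) = 2 * (row lam k - k - 1) + 1"
      using \<open>k < row lam k\<close> by simp
  qed simp
  also have "\<dots> = (\<Sum>d\<in>diag lam. 2 * d + 1)"
  proof (rule sum.reindex_bij_betw)
    have "inj_on (\<lambda>k. row lam k - k - 1) I"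
    proof (rule inj_onI)
      fix k l assume "k \<in> I" "l \<in> I" "row lam k - k - 1 = row lam l - l - 1"
      then have "beta lam k = beta lam l" by (auto simp: I_def beta_def)
      then show "k = l" using beta_inject[OF p] by simp
    qed
    moreover have *: "k \<in> I \<and> e = row lam k - k - 1 \<longleftrightarrow> row lam k = e + k + 1" for e k
      unfolding I_def mem_Collect_eq by linarith
    have "(\<lambda>k. row lam k - k - 1) ` I = diag lam"
      unfolding set_eq_iff image_iff Bex_def mem_diag_iff * by simp
    ultimately show "bij_betw (\<lambda>k. row lam k - k - 1) I (diag lam)"
      by (simp add: bij_betw_def)
  qed
  finally show ?thesis .
qed

text \<open>The first set describes the steps from \<open>s\<close> to \<open>s - t\<close> inside the nonnegative numbers,
  which self-conjugacy mirrors to those inside the negative numbers; the second set describes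
  the steps that cross zero.\<close>
definition hook_count :: "nat \<Rightarrow> nat set \<Rightarrow> nat" where
  "hook_count t D = 2 * card {i. i + t \<in> D \<and> i \<notin> D} + card {i \<in> D. i < t \<and> t - 1 - i \<in> D}"

lemma card_beta_steps:
  assumes "lam \<in> SC" "0 < t"
  shows "card {s \<in> range (beta lam). s - int t \<notin> range (beta lam)} = hook_count t (diag lam)"
proof -
  let ?D = "diag lam"
  let ?A = "{i. i + t \<in> ?D \<and> i \<notin> ?D}" and ?B = "{i \<in> ?D. i < t \<and> t - 1 - i \<in> ?D}"
  have fin: "finite ?D"
    using diag_bij assms(1) by (auto simp: bij_betw_def)
  have finA: "finite ?A"
    using finite_vimageI[OF fin, of "\<lambda>i. i + t"] by (rule rev_finite_subset) (auto simp: inj_on_def)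
  have finB: "finite ?B" using fin by simp
  note mem = mem_range_beta_iff[OF assms(1)]
  have "{s \<in> range (beta lam). s - int t \<notin> range (beta lam)} =
      (\<lambda>i. int (i + t)) ` ?A \<union> int ` ?B \<union> (\<lambda>i. - 1 - int i) ` ?A"
    (is "?L = ?R1 \<union> ?R2 \<union> ?R3")
  proof (intro set_eqI)
    fix s
    consider (1) i where "s = int (i + t)" | (2) i where "s = int i" "i < t" | (3) i where "s = - 1 - int i"
    proof (cases "0 \<le> s")
      case True
      then show thesis
        using that(1)[of "nat (s - int t)"] that(2)[of "nat s"] by (cases "int t \<le> s") auto
    next
      case False
      then show thesis using that(3)[of "nat (- 1 - s)"] by simp
    qed
    then show "s \<in> ?L \<longleftrightarrow> s \<in> ?R1 \<union> ?R2 \<union> ?R3"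
    proof cases
      case (1 i)
      have "s \<in> ?L \<longleftrightarrow> i + t \<in> ?D \<and> i \<notin> ?D"
        unfolding mem_Collect_eq mem by (simp add: 1 nat_add_distrib)
      with 1 show ?thesis by auto
    next
      case (2 i)
      have "nat (- 1 - (int i - int t)) = t - 1 - i" using 2 by linarith
      then have "s \<in> ?L \<longleftrightarrow> i \<in> ?D \<and> t - 1 - i \<in> ?D"
        unfolding mem_Collect_eq mem using 2 by simp
      with 2 show ?thesis by auto
    next
      \<comment> \<open>By reflection, \<open>- 1 - i\<close> is a beta number iff \<open>i\<close>
        is outside the diagonal set, and \<open>- 1 - (i + t)\<close> is missing iff
        \<open>i + t\<close> lies in it.\<close>
      case (3 i)
      have "nat (- 1 - (- 1 - int i - int t)) = i + t" by simp
      then have "s \<in> ?L \<longleftrightarrow> i + t \<in> ?D \<and> i \<notin> ?D"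
        unfolding mem_Collect_eq mem using 3 by (simp add: conj_commute)
      with 3 show ?thesis by auto
    qed
  qed
  moreover have "card (?R1 \<union> ?R2 \<union> ?R3) = card ?R1 + card ?R2 + card ?R3"
    by (subst card_Un_disjoint, (use finA finB in auto)[3])+ simp
  moreover have "card ?R1 = card ?A" "card ?R2 = card ?B" "card ?R3 = card ?A"
    by (auto intro!: card_image simp: inj_on_def)
  ultimately show ?thesis by (simp add: hook_count_def)
qed

text \<open>For self-conjugate partitions the hook length is
  \<open>beta lam i + beta lam j + 1\<close>. A cell with hook length \<open>t\<close> is thus a
  beta number \<open>s\<close> together with \<open>s - t = - 1 - beta lam j\<close>, which is not
  one by reflection.\<close>

lemma n_hook_SC:
  assumes "lam \<in> SC" "0 < t"
  shows "n_hook t lam = hook_count t (diag lam)"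
proof -
  have p: "is_partition lam" and sym: "\<And>i j. j < row lam i \<longleftrightarrow> i < row lam j"
    and sc: "conjugate lam = lam"
    using assms(1) SC_iff[of lam] by (simp_all add: SC_def self_conjugate_def)
  have hook: "int (hook_length lam i j) = beta lam i + beta lam j + 1" if "(i, j) \<in> cells lam" for i j
  proof -
    have ij: "j < row lam i" "i < row lam j"
      using that sym by (auto simp: mem_cells_iff)
    then have "lam ! i = row lam i" "lam ! j = row lam j"
      by (auto simp: row_def split: if_splits)
    with ij show ?thesis by (simp add: hook_length_def sc beta_def)
  qed
  let ?H = "{(i, j) \<in> cells lam. hook_length lam i j = t}"
  let ?S = "{s \<in> range (beta lam). s - int t \<notin> range (beta lam)}"
  have "bij_betw (\<lambda>(i, j). beta lam i) ?H ?S"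
  proof (rule bij_betw_imageI)
    show "inj_on (\<lambda>(i, j). beta lam i) ?H"
    proof (rule inj_onI, clarify)
      fix i j k l
      assume ij: "(i, j) \<in> cells lam" and kl: "(k, l) \<in> cells lam"
        and t: "t = hook_length lam i j" "hook_length lam k l = hook_length lam i j"
        and eq: "beta lam i = beta lam k"
      then have "beta lam j = beta lam l"
        using hook[OF ij] hook[OF kl] by simp
      with eq show "i = k \<and> j = l"
        by (simp add: beta_inject[OF p])
    qed
    show "(\<lambda>(i, j). beta lam i) ` ?H = ?S"
    proof (intro equalityI subsetI)
      fix s assume "s \<in> (\<lambda>(i, j). beta lam i) ` ?H"
      then obtain i j where ij: "(i, j) \<in> cells lam" "hook_length lam i j = t" "s = beta lam i"
        by auto
      then have "- 1 - (s - int t) = beta lam j"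
        using hook[of i j] by simp
      then have "- 1 - (s - int t) \<in> range (beta lam)" by simp
      then show "s \<in> ?S"
        using beta_reflect[OF assms(1), of "s - int t"] ij by simp
    next
      fix s assume s: "s \<in> ?S"
      then obtain i where i: "s = beta lam i" by auto
      from s have "- 1 - (s - int t) \<in> range (beta lam)"
        using beta_reflect[OF assms(1), of "s - int t"] by simp
      then obtain j where j: "- 1 - (s - int t) = beta lam j" by auto
      \<comment> \<open>As \<open>t\<close> is positive,
        \<open>row lam i + row lam j > i + j + 1\<close>, so one of the two cells
        \<open>(i, j)\<close>, \<open>(j, i)\<close> is present and symmetry gives both.\<close>
      have "(i, j) \<in> cells lam"
        using i j \<open>0 < t\<close> sym[of j i] unfolding mem_cells_iff beta_def by linarith
      moreover from hook[OF this] have "hook_length lam i j = t"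
        using i j by simp
      ultimately show "s \<in> (\<lambda>(i, j). beta lam i) ` ?H"
        using i by (auto simp: image_iff)
    qed
  qed
  then have "n_hook t lam = card ?S"
    unfolding n_hook_def by (rule bij_betw_same_card)
  then show ?thesis
    using card_beta_steps[OF assms] by simp
qed

subsection \<open>Sums over finite sets as transfer recurrences\<close>

text \<open>Occupying site 0 is not counted as a rise; its weight depends on what precedes and
  enters through \<open>p\<close> in \<open>zsum\<close>.\<close>

definition rises :: "nat set \<Rightarrow> nat" where
  "rises E = card {k. Suc k \<in> E \<and> k \<notin> E}"

lemma finite_rises: "finite E \<Longrightarrow> finite {k. Suc k \<in> E \<and> k \<notin> E}"
  by (rule finite_subset[OF _ finite_vimageI[of E Suc]]) auto

lemma rises_empty [simp]: "rises {} = 0"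
  by (simp add: rises_def)

lemma rises_insert_Suc_new:
  assumes "E \<subseteq> {..<N}"
  shows "rises (insert (Suc N) E) = Suc (rises E)"
proof -
  have "{k. Suc k \<in> insert (Suc N) E \<and> k \<notin> insert (Suc N) E} =
      insert N {k. Suc k \<in> E \<and> k \<notin> E}"
    using assms by (auto dest: subsetD)
  moreover have "finite {k. Suc k \<in> E \<and> k \<notin> E}"
    using assms by (intro finite_rises) (rule finite_subset, auto)
  moreover have "N \<notin> {k. Suc k \<in> E \<and> k \<notin> E}"
    using assms by auto
  ultimately show ?thesis
    by (simp add: rises_def)
qed

lemma rises_insert_Suc_old:
  assumes "E \<subseteq> {..<N}"
  shows "rises (insert (Suc N) (insert N E)) = rises (insert N E)"
proof -
  have "{k. Suc k \<in> insert (Suc N) (insert N E) \<and> k \<notin> insert (Suc N) (insert N E)} =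
      {k. Suc k \<in> insert N E \<and> k \<notin> insert N E}"
    using assms by (auto dest: subsetD)
  then show ?thesis by (simp add: rises_def)
qed

lemma sum_Pow_lessThan_Suc:
  fixes f :: "nat set \<Rightarrow> 'b::comm_monoid_add"
  shows "(\<Sum>E\<in>Pow {..<Suc N}. f E) = (\<Sum>E\<in>Pow {..<N}. f E) + (\<Sum>E\<in>Pow {..<N}. f (insert N E))"
proof -
  have "(\<Sum>E\<in>Pow {..<Suc N}. f E) = (\<Sum>E\<in>Pow {..<N} \<union> insert N ` Pow {..<N}. f E)"
    by (simp add: lessThan_Suc Pow_insert)
  also have "\<dots> = (\<Sum>E\<in>Pow {..<N}. f E) + (\<Sum>E\<in>insert N ` Pow {..<N}. f E)"
    by (rule sum.union_disjoint) auto
  also have "(\<Sum>E\<in>insert N ` Pow {..<N}. f E) = (\<Sum>E\<in>Pow {..<N}. f (insert N E))"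
    by (rule sum.reindex_cong[of "insert N"]) (auto simp: inj_on_def dest: insert_ident[THEN iffD1, rotated 2])
  finally show ?thesis .
qed

section \<open>Finite words with a boundary weight\<close>

context
  fixes y :: "'a::field fps" and z :: "nat \<Rightarrow> 'a fps" and p :: "bool \<Rightarrow> 'a fps"
begin

definition zsum :: "nat \<Rightarrow> 'a fps" where
  "zsum N = (\<Sum>E\<in>Pow {..<N}. y ^ rises E * (\<Prod>i\<in>E. z i) * p (0 \<in> E))"

text \<open>Site \<open>N\<close> is occupied and counts for rises, but its weight
  \<open>z N\<close> is left out and supplied by the recurrences.\<close>

definition ysum :: "nat \<Rightarrow> 'a fps" where
  "ysum N = (\<Sum>E\<in>Pow {..<N}. y ^ rises (insert N E) * (\<Prod>i\<in>E. z i) * p (0 \<in> insert N E))"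

lemma zsum_0: "zsum 0 = p False" and ysum_0: "ysum 0 = p True"
proof -
  have "rises {0} = 0" by (simp add: rises_def)
  then show "zsum 0 = p False" "ysum 0 = p True" by (simp_all add: zsum_def ysum_def)
qed

lemma prod_insert_Pow:
  assumes "E \<in> Pow {..<N}"
  shows "(\<Prod>i\<in>insert N E. z i) = z N * (\<Prod>i\<in>E. z i)"
proof (rule prod.insert)
  show "finite E" using assms by (auto intro: finite_subset)
  show "N \<notin> E" using assms by auto
qed

lemma zsum_Suc: "zsum (Suc N) = zsum N + z N * ysum N"
  unfolding zsum_def ysum_def sum_Pow_lessThan_Suc sum_distrib_left
  by (intro arg_cong2[of _ _ _ _ "(+)"] refl sum.cong) (simp add: prod_insert_Pow mult_ac)

lemma ysum_Suc: "ysum (Suc N) = y * zsum N + z N * ysum N"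
  unfolding zsum_def ysum_def sum_Pow_lessThan_Suc sum_distrib_left
proof (intro arg_cong2[of _ _ _ _ "(+)"] sum.cong refl)
  fix E assume E: "E \<in> Pow {..<N}"
  show "y ^ rises (insert (Suc N) E) * (\<Prod>i\<in>E. z i) * p (0 \<in> insert (Suc N) E) =
      y * (y ^ rises E * (\<Prod>i\<in>E. z i) * p (0 \<in> E))"
    using E by (simp add: rises_insert_Suc_new mult_ac)
  show "y ^ rises (insert (Suc N) (insert N E)) * (\<Prod>i\<in>insert N E. z i) * p (0 \<in> insert (Suc N) (insert N E)) =
      z N * (y ^ rises (insert N E) * (\<Prod>i\<in>E. z i) * p (0 \<in> insert N E))"
    using E by (simp add: rises_insert_Suc_old prod_insert_Pow mult_ac)
qed

end

section \<open>Infinite limits of the word sums\<close>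

lemma zsum_approx:
  fixes Q a c :: "'a::field fps"
  assumes "Q $ 0 = 0" "a $ 0 = 0"
  shows "fps_X ^ N dvd zsum (1 + c) (\<lambda>i. a * Q ^ i) p N - (p False * vsol Q a c 1 + p True * a * wsol Q a c 1)"
  using transfer_approx[OF assms, where Z = "zsum (1 + c) (\<lambda>i. a * Q ^ i) p"
      and Y = "ysum (1 + c) (\<lambda>i. a * Q ^ i) p", OF zsum_Suc ysum_Suc]
  by (simp only: zsum_0 ysum_0)

text \<open>The boundary weight is the complete sum over the right half, so the left extension obeys
  the recurrences of \<open>zbi\<close> and \<open>ybi\<close> with the same start values.\<close>

lemma zsum_bi:
  fixes Q a b c :: "'a::field fps"
  assumes "Q $ 0 = 0" "a $ 0 = 0" "a * b = Q"
  shows "zsum (1 + c) (\<lambda>i. b * Q ^ i) (\<lambda>e. if e then vsol Q a c 0 else wsol Q a c 0) N = zbi Q a b c N"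
proof -
  let ?p = "\<lambda>e. if e then vsol Q a c 0 else wsol Q a c 0"
  have "zsum (1 + c) (\<lambda>i. b * Q ^ i) ?p N = zbi Q a b c N \<and>
      ysum (1 + c) (\<lambda>i. b * Q ^ i) ?p N = ybi Q a b c N"
    by (induction N)
       (simp_all add: zsum_0 ysum_0 zsum_Suc ysum_Suc zbi_0[OF assms] ybi_0[OF assms]
         zbi_Suc[OF assms] ybi_Suc[OF assms])
  then show ?thesis ..
qed

text \<open>The extra factor \<open>y\<close> for 0 in both sets is the rise across the origin. It
  accounts for two hooks, as both members of a mirror pair are counted in the second part of
  \<open>hook_count\<close>.\<close>

definition pair_sum :: "'a::field fps \<Rightarrow> (nat \<Rightarrow> 'a fps) \<Rightarrow> (nat \<Rightarrow> 'a fps) \<Rightarrow> nat \<Rightarrow> 'a fps" where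
  "pair_sum y z z' N = (\<Sum>(E, E')\<in>Pow {..<N} \<times> Pow {..<N}.
     y ^ (rises E + rises E' + (if 0 \<in> E \<and> 0 \<in> E' then 1 else 0)) *
     ((\<Prod>i\<in>E. z i) * (\<Prod>i\<in>E'. z' i)))"

lemma pair_sum_tendsto:
  fixes Q a b c :: "'a::field fps"
  assumes Q0: "Q $ 0 = 0" and a0: "a $ 0 = 0" and ab: "a * b = Q"
  shows "pair_sum (1 + c) (\<lambda>i. a * Q ^ i) (\<lambda>i. b * Q ^ i) \<longlonglongrightarrow>
    qpoch_inf (- a) Q * qpoch_inf (- b) Q * qpoch_inf (- c * Q) Q"
proof -
  define y where "y = 1 + c"
  define za where "za = (\<lambda>i. a * Q ^ i)"
  define zb where "zb = (\<lambda>i. b * Q ^ i)"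
  define p where "p = (\<lambda>e'. \<lambda>e. if e \<and> e' then y else 1)"
  define r where "r = (\<lambda>e. if e then vsol Q a c 0 else wsol Q a c 0)"
  \<comment> \<open>The right half is summed first. The recurrences at 0 absorb the boundary weight:
    the site before 0 is empty, giving \<open>vsol\<close>, exactly when \<open>e'\<close>
    holds.\<close>
  have inner: "fps_X ^ N dvd zsum y za (p e') N - r e'" for N e'
    using zsum_approx[OF Q0 a0, of N c "p e'"] vsol_rec[OF Q0 a0, of c 0] wsol_rec[OF Q0 a0, of c 0]
    by (cases e') (simp_all add: p_def r_def y_def za_def)
  have "pair_sum y za zb N =
      (\<Sum>E'\<in>Pow {..<N}. y ^ rises E' * (\<Prod>i\<in>E'. zb i) * zsum y za (p (0 \<in> E')) N)" for N
    unfolding pair_sum_def zsum_def sum_distrib_left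
    by (subst sum.swap, subst sum.cartesian_product)
       (intro sum.cong, auto simp: p_def power_add mult_ac)
  then have "pair_sum y za zb N - zsum y zb r N =
      (\<Sum>E'\<in>Pow {..<N}. y ^ rises E' * (\<Prod>i\<in>E'. zb i) * (zsum y za (p (0 \<in> E')) N - r (0 \<in> E')))" for N
    unfolding zsum_def[of y zb] right_diff_distrib sum_subtractf by simp
  then have "fps_X ^ N dvd pair_sum y za zb N - zsum y zb r N" for N
    by (simp only:) (intro dvd_sum dvd_mult inner)
  then have "(\<lambda>N. pair_sum y za zb N - zsum y zb r N) \<longlonglongrightarrow> 0"
    by (intro LIMSEQ_fpsI_dvd) simp
  moreover have "zsum y zb r \<longlonglongrightarrow> qpoch_inf (- a) Q * qpoch_inf (- b) Q * qpoch_inf (- c * Q) Q"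
    unfolding y_def zb_def r_def zsum_bi[OF Q0 a0 ab] by (rule zbi_tendsto[OF Q0 a0 ab])
  ultimately have "(\<lambda>N. (pair_sum y za zb N - zsum y zb r N) + zsum y zb r N) \<longlonglongrightarrow>
      0 + qpoch_inf (- a) Q * qpoch_inf (- b) Q * qpoch_inf (- c * Q) Q"
    by (rule tendsto_fps_add)
  then show ?thesis
    by (simp add: y_def za_def zb_def)
qed

subsection \<open>Splitting into residue classes\<close>

text \<open>A subset of \<open>{..<t * M}\<close> is the same as an independent choice of its
  \<open>t\<close> residue classes, and the sum over such choices factors.\<close>

lemma sum_Pow_residues:
  fixes f :: "nat set \<Rightarrow> 'b::comm_semiring_1" and g :: "nat \<Rightarrow> nat set \<Rightarrow> nat set \<Rightarrow> 'b"
  assumes t: "t = 2 * h + 1"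
  shows "(\<Sum>D\<in>Pow {..<t * M}. f {j. h + t * j \<in> D} *
           (\<Prod>r<h. g r {j. r + t * j \<in> D} {j. t - 1 - r + t * j \<in> D})) =
         (\<Sum>E\<in>Pow {..<M}. f E) * (\<Prod>r<h. \<Sum>(E, E')\<in>Pow {..<M} \<times> Pow {..<M}. g r E E')"
proof -
  let ?S = "Pow {..<M} \<times> Pow {..<M}"
  define cls where "cls D r = {j. r + t * j \<in> D}" for D r
  \<comment> \<open>Inverse of the splitting: residues below \<open>h\<close> use first components,
    and those above use the second component stored under the mirror residue.\<close>
  define join :: "nat set \<times> (nat \<Rightarrow> nat set \<times> nat set) \<Rightarrow> nat set"
    where "join = (\<lambda>(E, G).
    {i. if i mod t = h then i div t \<in> E
        else if i mod t < h then i div t \<in> fst (G (i mod t))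
        else i div t \<in> snd (G (t - 1 - i mod t))})"
  have t0: "0 < t" using t by simp
  have div_less: "i div t < M \<longleftrightarrow> i < t * M" for i
    using t0 by (simp add: div_less_iff_less_mult mult.commute)
  have lt: "r + t * j < t * M \<longleftrightarrow> j < M" if "r < t" for r j
    using div_less[of "r + t * j"] that by simp
  have sub: "cls D r \<subseteq> {..<M}" if "D \<in> Pow {..<t * M}" "r < t" for D r
    using that lt by (auto simp: cls_def)
  have "(\<Sum>E\<in>Pow {..<M}. f E) * (\<Prod>r<h. \<Sum>(E, E')\<in>?S. g r E E') =
      (\<Sum>E\<in>Pow {..<M}. f E) * (\<Sum>G\<in>PiE {..<h} (\<lambda>_. ?S). \<Prod>r<h. case G r of (E, E') \<Rightarrow> g r E E')"
    by (subst prod_sum_PiE) auto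
  also have "\<dots> = (\<Sum>(E, G)\<in>Pow {..<M} \<times> PiE {..<h} (\<lambda>_. ?S).
      f E * (\<Prod>r<h. case G r of (E, E') \<Rightarrow> g r E E'))"
    by (simp add: sum_product sum.cartesian_product)
  also have "\<dots> = (\<Sum>D\<in>Pow {..<t * M}. f (cls D h) * (\<Prod>r<h. g r (cls D r) (cls D (t - 1 - r))))"
  proof (rule sum.reindex_bij_witness[of _
        "\<lambda>D. (cls D h, restrict (\<lambda>r. (cls D r, cls D (t - 1 - r))) {..<h})" join])
    fix x assume x: "x \<in> Pow {..<M} \<times> PiE {..<h} (\<lambda>_. ?S)"
    obtain E G where EG: "x = (E, G)" by (cases x)
    have E: "E \<subseteq> {..<M}" and G: "\<And>r. r < h \<Longrightarrow> fst (G r) \<subseteq> {..<M} \<and> snd (G r) \<subseteq> {..<M}"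
      and ext: "G \<in> extensional {..<h}"
      using x EG by (auto simp: PiE_iff mem_Times_iff)
    have c1: "cls (join x) h = E"
    proof -
      have "h < t" using t by simp
      then show ?thesis unfolding cls_def join_def EG by simp
    qed
    have c2: "cls (join x) r = fst (G r)" "cls (join x) (t - 1 - r) = snd (G r)" if "r < h" for r
    proof -
      define r' where "r' = t - 1 - r"
      have "r' < t" "r' \<noteq> h" "\<not> r' < h" "t - 1 - r' = r" "r < t" "r \<noteq> h"
        using that t by (auto simp: r'_def)
      then show "cls (join x) r = fst (G r)" "cls (join x) (t - 1 - r) = snd (G r)"
        using that unfolding cls_def join_def EG r'_def[symmetric] by simp_all
    qed
    show "(cls (join x) h, restrict (\<lambda>r. (cls (join x) r, cls (join x) (t - 1 - r))) {..<h}) = x"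
      using c1 c2 ext EG by (auto simp: extensional_def fun_eq_iff restrict_def)
    show "join x \<in> Pow {..<t * M}"
    proof
      show "join x \<subseteq> {..<t * M}"
      proof
        fix i assume i: "i \<in> join x"
        have "i mod t < t" using t0 by simp
        then have "t - 1 - i mod t < h" if "i mod t \<noteq> h" "\<not> i mod t < h"
          using that t by linarith
        then have "i div t < M"
          using i E G[of "i mod t"] G[of "t - 1 - i mod t"]
          unfolding join_def EG by (auto split: if_splits)
        then show "i \<in> {..<t * M}" by (simp add: div_less)
      qed
    qed
    show "f (cls (join x) h) * (\<Prod>r<h. g r (cls (join x) r) (cls (join x) (t - 1 - r))) =
        (case x of (E, G) \<Rightarrow> f E * (\<Prod>r<h. case G r of (E, E') \<Rightarrow> g r E E'))"
      using c1 c2 by (simp add: EG case_prod_beta)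
  next
    fix D assume D: "D \<in> Pow {..<t * M}"
    show "(cls D h, restrict (\<lambda>r. (cls D r, cls D (t - 1 - r))) {..<h}) \<in> Pow {..<M} \<times> PiE {..<h} (\<lambda>_. ?S)"
      using sub[OF D] t by auto
    show "join (cls D h, restrict (\<lambda>r. (cls D r, cls D (t - 1 - r))) {..<h}) = D"
    proof (intro set_eqI)
      fix i
      have "i mod t < t" using t0 by simp
      then have "t - 1 - i mod t < h" if "i mod t \<noteq> h" "\<not> i mod t < h"
        using that t by linarith
      moreover have "t - 1 - (t - 1 - i mod t) = i mod t"
        using \<open>i mod t < t\<close> by linarith
      ultimately show "i \<in> join (cls D h, restrict (\<lambda>r. (cls D r, cls D (t - 1 - r))) {..<h}) \<longleftrightarrow> i \<in> D"
        unfolding join_def cls_def by (auto simp: mod_mult_div_eq)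
    qed
  qed
  finally show ?thesis by (simp add: cls_def)
qed

lemma prod_residues:
  fixes w :: "nat \<Rightarrow> 'b::comm_monoid_mult"
  assumes "finite A" "0 < t"
  shows "(\<Prod>i\<in>A. w i) = (\<Prod>r<t. \<Prod>j\<in>{j. r + t * j \<in> A}. w (r + t * j))"
proof -
  have fin: "finite {j. r + t * j \<in> A}" for r
    using finite_vimageI[OF assms(1), of "\<lambda>j. r + t * j"] assms(2)
    by (simp add: vimage_def inj_on_def)
  have "(\<Prod>r<t. \<Prod>j\<in>{j. r + t * j \<in> A}. w (r + t * j)) =
      (\<Prod>(r, j)\<in>Sigma {..<t} (\<lambda>r. {j. r + t * j \<in> A}). w (r + t * j))"
    by (rule prod.Sigma) (auto simp: fin)
  also have "\<dots> = (\<Prod>i\<in>A. w i)"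
    by (rule prod.reindex_bij_witness[of _ "\<lambda>i. (i mod t, i div t)" "\<lambda>(r, j). r + t * j"])
       (use assms(2) in auto)
  finally show ?thesis ..
qed

text \<open>The product formula for the constant weight 2, with exponents compared.\<close>

lemma card_residues:
  fixes A :: "nat set"
  assumes "finite A" "0 < t"
  shows "card A = (\<Sum>r<t. card {j. r + t * j \<in> A})"
proof -
  have "(2::nat) ^ card A = 2 ^ (\<Sum>r<t. card {j. r + t * j \<in> A})"
    using prod_residues[OF assms, of "\<lambda>_. 2::nat"] by (simp add: power_sum)
  then show ?thesis by simp
qed

lemma prod_lessThan_odd:
  fixes w :: "nat \<Rightarrow> 'b::comm_monoid_mult"
  assumes t: "t = 2 * h + 1"
  shows "(\<Prod>r<t. w r) = w h * (\<Prod>r<h. w r * w (t - 1 - r))"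
proof -
  have "{..<t} = insert h ({..<h} \<union> {h<..<t})"
    using t by auto
  then have "(\<Prod>r<t. w r) = prod w (insert h ({..<h} \<union> {h<..<t}))"
    by (rule arg_cong)
  also have "\<dots> = w h * prod w ({..<h} \<union> {h<..<t})"
    by (rule prod.insert) auto
  also have "prod w ({..<h} \<union> {h<..<t}) = (\<Prod>r<h. w r) * (\<Prod>r\<in>{h<..<t}. w r)"
    by (rule prod.union_disjoint) auto
  also have "(\<Prod>r\<in>{h<..<t}. w r) = (\<Prod>r<h. w (t - 1 - r))"
    by (rule prod.reindex_bij_witness[of _ "\<lambda>r. t - 1 - r" "\<lambda>r. t - 1 - r"]) (use t in auto)
  finally show ?thesis by (simp add: prod.distrib)
qed

text \<open>The numbers \<open>i\<close> and \<open>i + t\<close> are neighbouring sites of one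
  residue class, so steps of length \<open>t\<close> become rises.\<close>

lemma hook_count_residues:
  assumes D: "finite D" and t: "0 < t"
  shows "hook_count t D = 2 * (\<Sum>r<t. rises {j. r + t * j \<in> D}) +
    (\<Sum>r<t. if r \<in> D \<and> t - 1 - r \<in> D then 1 else 0)"
proof -
  have fin: "finite {i. i + t \<in> D \<and> i \<notin> D}"
    using finite_vimageI[OF D, of "\<lambda>i. i + t"] by (rule rev_finite_subset) (auto simp: inj_on_def)
  have "{i \<in> D. i < t \<and> t - 1 - i \<in> D} = {r \<in> {..<t}. r \<in> D \<and> t - 1 - r \<in> D}"
    by auto
  then have "card {i \<in> D. i < t \<and> t - 1 - i \<in> D} =
      (\<Sum>r<t. if r \<in> D \<and> t - 1 - r \<in> D then 1 else 0)"
    by (simp add: sum.inter_filter[symmetric])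
  moreover have "card {j. r + t * j \<in> {i. i + t \<in> D \<and> i \<notin> D}} = rises {j. r + t * j \<in> D}" for r
    by (simp add: rises_def algebra_simps)
  ultimately show ?thesis
    unfolding hook_count_def card_residues[OF fin t] by simp
qed

section \<open>Truncated generating functions and their factorization\<close>

definition set_gf :: "nat \<Rightarrow> 'a::field \<Rightarrow> nat \<Rightarrow> 'a fps" where
  "set_gf t x K = (\<Sum>D\<in>Pow {..<K}. fps_const (x ^ hook_count t D) * (\<Prod>d\<in>D. fps_X ^ (2 * d + 1)))"

text \<open>Every \<open>d\<close> in a set of total weight \<open>N\<close> satisfies
  \<open>2 * d + 1 \<le> N\<close>, so truncation at \<open>K > N\<close> loses nothing.\<close>

lemma set_gf_nth:
  assumes "0 < t" "N < K"
  shows "set_gf t x K $ N = sc_gf t x $ N"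
proof -
  let ?A = "{lam \<in> SC. psize lam = N}" and ?B = "{D \<in> Pow {..<K}. (\<Sum>d\<in>D. 2 * d + 1) = N}"
  have "bij_betw diag ?A ?B"
  proof (rule bij_betw_imageI)
    show "inj_on diag ?A"
      using diag_inj by (rule inj_on_subset) auto
    have sub: "D \<subseteq> {..<K}" if "finite D" "(\<Sum>d\<in>D. 2 * d + 1) = N" for D
    proof
      fix d assume "d \<in> D"
      then have "2 * d + 1 \<le> (\<Sum>d\<in>D. 2 * d + 1)"
        using \<open>finite D\<close> by (intro member_le_sum) auto
      then show "d \<in> {..<K}" using that(2) assms(2) by simp
    qed
    have fin: "finite (diag lam)" if "lam \<in> SC" for lam
      using diag_bij that by (auto simp: bij_betw_def)
    show "diag ` ?A = ?B"
    proof (intro equalityI subsetI)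
      fix D assume "D \<in> diag ` ?A"
      then obtain lam where lam: "lam \<in> SC" "psize lam = N" "D = diag lam" by auto
      then show "D \<in> ?B"
        using sub[OF fin[OF lam(1)]] psize_SC[OF lam(1)] by auto
    next
      fix D assume D: "D \<in> ?B"
      then have "finite D" by (auto intro: finite_subset)
      then obtain lam where lam: "lam \<in> SC" "diag lam = D" using diag_surj by blast
      then show "D \<in> diag ` ?A"
        using D psize_SC[OF lam(1)] by auto
    qed
  qed
  then have "(\<Sum>lam\<in>?A. x ^ hook_count t (diag lam)) = (\<Sum>D\<in>?B. x ^ hook_count t D)"
    by (rule sum.reindex_bij_betw)
  also have "\<dots> = (\<Sum>D\<in>Pow {..<K}. if (\<Sum>d\<in>D. 2 * d + 1) = N then x ^ hook_count t D else 0)"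
    by (rule sum.inter_filter) simp
  also have "\<dots> = set_gf t x K $ N"
    unfolding set_gf_def fps_sum_nth power_sum[symmetric]
    by (intro sum.cong) (auto simp: fps_X_power_nth)
  finally show ?thesis
    using n_hook_SC[OF _ assms(1)] by (simp add: sc_gf_def cong: sum.cong_simp)
qed

text \<open>The crossing indicator \<open>s\<close> occurs once for the self-mirrored residue
  \<open>h\<close>, giving \<open>x\<close>, and twice for a mirror pair, giving
  \<open>x ^ 2 = y\<close>.\<close>

lemma set_gf_factor:
  fixes x :: "'a::field"
  assumes t: "t = 2 * h + 1"
  defines "y \<equiv> fps_const (x ^ 2)" and "Q \<equiv> fps_X ^ (2 * t)"
  shows "set_gf t x (t * M) =
    zsum y (\<lambda>i. fps_X ^ t * Q ^ i) (\<lambda>e. if e then fps_const x else 1) M *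
    (\<Prod>r<h. pair_sum y (\<lambda>i. fps_X ^ (2 * r + 1) * Q ^ i) (\<lambda>i. fps_X ^ (2 * (t - 1 - r) + 1) * Q ^ i) M)"
proof -
  define z where "z r i = (fps_X ^ (2 * r + 1) * Q ^ i :: 'a fps)" for r i
  define f where "f E = y ^ rises E * (\<Prod>i\<in>E. z h i) * (if 0 \<in> E then fps_const x else 1)" for E
  define g where "g r E E' = y ^ (rises E + rises E' + (if 0 \<in> E \<and> 0 \<in> E' then 1 else 0)) *
     ((\<Prod>i\<in>E. z r i) * (\<Prod>i\<in>E'. z (t - 1 - r) i))" for r E E'
  define cls where "cls D r = {j. r + t * j \<in> D}" for D r
  have t0: "0 < t" using t by simp
  have "fps_const (x ^ hook_count t D) * (\<Prod>d\<in>D. fps_X ^ (2 * d + 1)) =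
      f (cls D h) * (\<Prod>r<h. g r (cls D r) (cls D (t - 1 - r)))"
    if "D \<in> Pow {..<t * M}" for D
  proof -
    have D: "finite D" using that by (auto intro: finite_subset)
    define s where "s r = (if r \<in> D \<and> t - 1 - r \<in> D then 1 else 0 :: nat)" for r
    define w where "w r = y ^ rises (cls D r) * fps_const x ^ s r * (\<Prod>j\<in>cls D r. z r j)" for r
    have "fps_const (x ^ hook_count t D) = y ^ (\<Sum>r<t. rises (cls D r)) * fps_const x ^ (\<Sum>r<t. s r)"
      unfolding hook_count_residues[OF D t0] y_def cls_def s_def
      by (simp only: fps_const_power fps_const_mult power_add power_mult)
    moreover have "(\<Prod>d\<in>D. fps_X ^ (2 * d + 1)) = (\<Prod>r<t. \<Prod>j\<in>cls D r. z r j)"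
      unfolding prod_residues[OF D t0] cls_def z_def Q_def
      by (intro prod.cong refl) (simp add: power_add power_mult[symmetric] algebra_simps)
    ultimately have "fps_const (x ^ hook_count t D) * (\<Prod>d\<in>D. fps_X ^ (2 * d + 1)) = (\<Prod>r<t. w r)"
      by (simp add: w_def power_sum prod.distrib)
    also have "\<dots> = w h * (\<Prod>r<h. w r * w (t - 1 - r))"
      by (rule prod_lessThan_odd[OF t])
    also have "w h = f (cls D h)"
      using t by (simp add: w_def f_def s_def cls_def)
    also have "(\<Prod>r<h. w r * w (t - 1 - r)) = (\<Prod>r<h. g r (cls D r) (cls D (t - 1 - r)))"
    proof (rule prod.cong)
      fix r assume "r \<in> {..<h}"
      then have "t - 1 - (t - 1 - r) = r" using t by simp
      then have "s (t - 1 - r) = s r" by (auto simp: s_def)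
      then have "w r * w (t - 1 - r) = y ^ rises (cls D r) * y ^ rises (cls D (t - 1 - r)) *
          (fps_const x ^ s r) ^ 2 * ((\<Prod>j\<in>cls D r. z r j) * (\<Prod>j\<in>cls D (t - 1 - r). z (t - 1 - r) j))"
        by (simp add: w_def power2_eq_square mult_ac)
      also have "(fps_const x ^ s r) ^ 2 = y ^ s r"
        by (simp add: y_def power_mult[symmetric] mult.commute)
      finally show "w r * w (t - 1 - r) = g r (cls D r) (cls D (t - 1 - r))"
        by (simp add: g_def power_add s_def cls_def)
    qed simp
    finally show ?thesis .
  qed
  then have "set_gf t x (t * M) = (\<Sum>E\<in>Pow {..<M}. f E) *
      (\<Prod>r<h. \<Sum>(E, E')\<in>Pow {..<M} \<times> Pow {..<M}. g r E E')"
    unfolding set_gf_def sum_Pow_residues[OF t, symmetric] cls_def by (rule sum.cong[OF refl])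
  then show ?thesis
    unfolding zsum_def pair_sum_def f_def g_def z_def using t by simp
qed

section \<open>Identification of the limit factors\<close>

lemma qpoch_inf_nth_0:
  fixes a q :: "'a::field fps"
  assumes "q $ 0 = 0" "a $ 0 = 0"
  shows "qpoch_inf a q $ 0 = 1"
proof -
  have "fps_X ^ 1 dvd a" using assms(2) unfolding fps_X_power_dvd_iff by simp
  then have "fps_X ^ 1 dvd qpoch_inf a q - 1"
    by (rule fps_X_power_dvd_qpoch_inf[OF assms(1)])
  then show ?thesis unfolding fps_X_power_dvd_iff by simp
qed

text \<open>The two series of \<open>Hstar\<close> are \<open>vsol\<close> at 1 and at 0 up to the
  infinite product. Eliminating \<open>vsol\<close> at 0 by its recurrence leaves boundary weights 1
  and \<open>x\<close> for site 0 empty or occupied.\<close>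

lemma Hstar_eq:
  fixes x :: "'a::field" and q :: "'a fps"
  assumes q0: "q $ 0 = 0" and x: "x \<noteq> 0"
  defines "c \<equiv> fps_const (x ^ 2 - 1)"
  shows "qpoch_inf (- q) (q ^ 2) * Hstar x q =
    vsol (q ^ 2) q c 1 + fps_const x * q * wsol (q ^ 2) q c 1"
proof -
  define Q where "Q = q ^ 2"
  define P where "P = qpoch_inf (- q) Q"
  have Q0: "Q $ 0 = 0" using q0 by (simp add: Q_def power2_eq_square)
  have "P $ 0 = 1"
    unfolding P_def using Q0 q0 by (intro qpoch_inf_nth_0) simp_all
  then have PP: "inverse P * P = 1"
    by (intro inverse_mult_eq_1) simp
  \<comment> \<open>The first series is the case \<open>m = 1\<close>, the second
    \<open>m = 0\<close>. Dividing by \<open>P\<close> turns the tail product in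
    \<open>v_term\<close> into the reciprocal of a finite product.\<close>
  have summand: "fps_const ((x ^ 2 - 1) ^ n) * q ^ k / (qpoch Q Q n * qpoch (- q) Q (m + n)) =
      inverse P * v_term Q q c m n"
    if k: "k = n + 2 * (n * m + n * (n - 1))" for k m n
  proof -
    define A where "A = qpoch (- q) Q (m + n)"
    have A0: "A $ 0 = 1" using q0 by (simp add: A_def qpoch_nth_0)
    have B0: "qpoch Q Q n $ 0 = 1" using Q0 by (simp add: qpoch_nth_0)
    have PA: "P = A * ptail Q q (m + n)"
      unfolding P_def A_def ptail_def[OF Q0 q0] by (subst qpoch_inf_split[OF Q0]) simp
    have AA: "inverse A * A = 1"
      using A0 by (intro inverse_mult_eq_1) simp
    have "inverse P * v_term Q q c m n =
        inverse P * (inverse A * A) * ptail Q q (m + n) * (c ^ n * q ^ n * Q ^ (n * m + n * (n - 1)) * qi Q n)"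
      unfolding AA by (simp add: v_term_def[OF Q0 q0] mult_ac)
    also have "\<dots> = (inverse P * P) * inverse A * (c ^ n * q ^ n * Q ^ (n * m + n * (n - 1)) * qi Q n)"
      unfolding PA by (simp add: mult_ac)
    also have "c ^ n * q ^ n * Q ^ (n * m + n * (n - 1)) * qi Q n = c ^ n * q ^ k * qi Q n"
    proof -
      have "q ^ n * Q ^ l = q ^ (n + 2 * l)" for l
        by (simp add: Q_def power_add power_mult)
      then have "q ^ n * Q ^ (n * m + n * (n - 1)) = q ^ k" unfolding k .
      then show ?thesis by (simp only: mult.assoc)
    qed
    also have "inverse P * P * inverse A * (c ^ n * q ^ k * qi Q n) =
        fps_const ((x ^ 2 - 1) ^ n) * q ^ k / (qpoch Q Q n * A)"
      using A0 B0 unfolding PP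
      by (simp add: fps_divide_unit fps_inverse_mult qi_def c_def fps_const_power mult_ac)
    finally show ?thesis
      unfolding A_def ..
  qed
  have ser: "P * fps_series (\<lambda>n. inverse P * v_term Q q c m n) = vsol Q q c m" for m
  proof -
    have "P * fps_series (\<lambda>n. inverse P * v_term Q q c m n) = (inverse P * P) * vsol Q q c m"
      unfolding vsol_def[OF Q0 q0] fps_series_cmult[OF rapid_v[OF Q0 q0]] by (simp add: mult_ac)
    then show ?thesis by (simp add: PP)
  qed
  have e1: "2 * n ^ 2 + n = n + 2 * (n * 1 + n * (n - 1))"
    and e0: "2 * n ^ 2 - n = n + 2 * (n * 0 + n * (n - 1))" for n :: nat
    by (cases n; simp add: power2_eq_square algebra_simps)+
  have "P * Hstar x q = (1 - fps_const (inverse x)) * (P * fps_series (\<lambda>n. inverse P * v_term Q q c 1 n)) +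
      fps_const (inverse x) * (P * fps_series (\<lambda>n. inverse P * v_term Q q c 0 n))"
    unfolding Hstar_def Q_def[symmetric] using summand[OF e1] summand[OF e0]
    by (simp add: algebra_simps)
  also have "\<dots> = (1 - fps_const (inverse x)) * vsol Q q c 1 + fps_const (inverse x) * vsol Q q c 0"
    by (simp only: ser)
  also have "vsol Q q c 0 = vsol Q q c 1 + fps_const (x ^ 2) * q * wsol Q q c 1"
  proof -
    have "1 + c = fps_const (x ^ 2)"
      by (simp add: c_def flip: fps_const_1_eq_1 fps_const_add)
    then show ?thesis
      using vsol_rec[OF Q0 q0, of c 0] by simp
  qed
  also have "(1 - fps_const (inverse x)) * vsol Q q c 1 +
      fps_const (inverse x) * (vsol Q q c 1 + fps_const (x ^ 2) * q * wsol Q q c 1) =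
      vsol Q q c 1 + (fps_const (inverse x) * fps_const (x ^ 2)) * q * wsol Q q c 1"
    by (simp only: algebra_simps) simp
  also have "fps_const (inverse x) * fps_const (x ^ 2) = fps_const x"
    using x by (simp add: power2_eq_square)
  finally show ?thesis
    by (simp add: P_def Q_def)
qed

text \<open>The factors \<open>1 + fps_X ^ (2 * i + 1)\<close> are sorted by the residue of
  \<open>i\<close> modulo \<open>t\<close>, and the residues are then paired with their
  mirrors.\<close>

lemma qpoch_inf_residues:
  assumes t: "t = 2 * h + 1"
  defines "P \<equiv> \<lambda>k. qpoch_inf (- (fps_X ^ k)) (fps_X ^ (2 * t)) :: 'a::field fps"
  shows "qpoch_inf (- fps_X) (fps_X ^ 2) = P t * (\<Prod>r<h. P (2 * r + 1) * P (2 * (t - 1 - r) + 1))"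
proof -
  have t0: "0 < t" using t by simp
  have "qpoch (- fps_X) (fps_X ^ 2) (t * M) =
      (\<Prod>r<t. qpoch (- (fps_X ^ (2 * r + 1))) (fps_X ^ (2 * t)) M :: 'a fps)" for M
  proof -
    have "{j. r + t * j \<in> {..<t * M}} = {..<M}" if "r < t" for r
    proof -
      have "r + t * j < t * M \<longleftrightarrow> j < M" for j
        using that t0 div_less_iff_less_mult[of t "r + t * j" M] by (simp add: mult.commute)
      then show ?thesis by auto
    qed
    then have "(\<Prod>i<t * M. 1 + fps_X ^ (2 * i + 1)) =
        (\<Prod>r<t. \<Prod>j<M. 1 + fps_X ^ (2 * (r + t * j) + 1) :: 'a fps)"
      by (subst prod_residues[OF _ t0]) simp_all
    then show ?thesis
      by (simp add: qpoch_def power_mult[symmetric] power_add[symmetric] algebra_simps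
          flip: power_Suc power_Suc2)
  qed
  moreover have "(\<lambda>M. \<Prod>r<t. qpoch (- (fps_X ^ (2 * r + 1))) (fps_X ^ (2 * t)) M) \<longlonglongrightarrow> (\<Prod>r<t. P (2 * r + 1))"
    unfolding P_def using t0 by (intro tendsto_intros qpoch_inf_LIMSEQ) (simp add: fps_X_power_nth)
  moreover have "(\<lambda>M. qpoch (- fps_X) (fps_X ^ 2) (t * M)) \<longlonglongrightarrow> (qpoch_inf (- fps_X) (fps_X ^ 2) :: 'a fps)"
    using LIMSEQ_subseq_LIMSEQ[OF qpoch_inf_LIMSEQ, of "fps_X ^ 2" "\<lambda>M. t * M" "- fps_X :: 'a fps"] t0
    by (simp add: o_def strict_mono_def fps_X_power_nth)
  ultimately have "qpoch_inf (- fps_X) (fps_X ^ 2) = (\<Prod>r<t. P (2 * r + 1))"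
    using LIMSEQ_unique by auto
  then show ?thesis
    unfolding prod_lessThan_odd[OF t] using t by simp
qed

section \<open>Assembly of the generating function\<close>

theorem theorem1p1:
  fixes t :: nat and x :: "'a::field"
  assumes "odd t" and "x \<noteq> 0"
  shows "sc_gf t x =
           qpoch_inf (- fps_X) (fps_X ^ 2) * Hstar x (fps_X ^ t) *
           (qpoch_inf (fps_const (1 - x^2) * fps_X ^ (2*t)) (fps_X ^ (2*t))) ^ ((t - 1) div 2)"
proof -
  define h where "h = (t - 1) div 2"
  have t: "t = 2 * h + 1" using assms(1) by (auto simp: h_def elim: oddE)
  then have t0: "0 < t" by simp
  define Q :: "'a fps" where "Q = fps_X ^ (2 * t)"
  define c where "c = fps_const (x ^ 2 - 1)"
  define P where "P k = qpoch_inf (- (fps_X ^ k)) Q" for k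
  define E where "E = qpoch_inf (- c * Q) Q"
  define S where "S = vsol Q (fps_X ^ t) c 1 + fps_const x * fps_X ^ t * wsol Q (fps_X ^ t) c 1"
  have X0: "(fps_X ^ k :: 'a fps) $ 0 = 0" if "0 < k" for k
    using that by (simp add: fps_X_power_nth)
  have Q0: "Q $ 0 = 0" unfolding Q_def using t0 by (intro X0) simp
  have y: "fps_const (x ^ 2) = 1 + c"
    by (simp add: c_def flip: fps_const_1_eq_1 fps_const_add)
  have self: "zsum (1 + c) (\<lambda>i. fps_X ^ t * Q ^ i) (\<lambda>e. if e then fps_const x else 1) \<longlonglongrightarrow> S"
    unfolding S_def
    using zsum_approx[OF Q0 X0[OF t0], of _ c "\<lambda>e. if e then fps_const x else 1"]
    by (intro LIMSEQ_fpsI_dvd) simp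
  have pair: "pair_sum (1 + c) (\<lambda>i. fps_X ^ (2 * r + 1) * Q ^ i) (\<lambda>i. fps_X ^ (2 * (t - 1 - r) + 1) * Q ^ i)
      \<longlonglongrightarrow> P (2 * r + 1) * P (2 * (t - 1 - r) + 1) * E" if "r < h" for r
    unfolding P_def E_def
  proof (rule pair_sum_tendsto[OF Q0 X0])
    show "fps_X ^ (2 * r + 1) * fps_X ^ (2 * (t - 1 - r) + 1) = Q"
      unfolding Q_def power_add[symmetric] using that t by (intro arg_cong2[of _ _ _ _ "(^)"]) auto
  qed simp
  \<comment> \<open>With \<open>M\<close> sites per residue class, the middle class tends to
    \<open>S\<close>, and each of the \<open>h\<close> mirror pairs contributes two infinite
    products and one factor \<open>E\<close>.\<close>
  have "(\<lambda>M. set_gf t x (t * M)) \<longlonglongrightarrow> S * (\<Prod>r<h. P (2 * r + 1) * P (2 * (t - 1 - r) + 1) * E)"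
    unfolding set_gf_factor[OF t] Q_def[symmetric] y
    by (intro tendsto_fps_mult tendsto_fps_prod self pair) simp
  moreover have "(\<lambda>M. set_gf t x (t * M)) \<longlonglongrightarrow> sc_gf t x"
  proof (rule tendsto_fpsI)
    fix N
    have "\<forall>\<^sub>F M in sequentially. N < M" by (rule eventually_gt_at_top)
    then show "\<forall>\<^sub>F M in sequentially. set_gf t x (t * M) $ N = sc_gf t x $ N"
    proof eventually_elim
      case (elim M)
      also have "M \<le> t * M" using t0 by simp
      finally show ?case by (rule set_gf_nth[OF t0])
    qed
  qed
  ultimately have "sc_gf t x = S * (\<Prod>r<h. P (2 * r + 1) * P (2 * (t - 1 - r) + 1) * E)"
    by (rule LIMSEQ_unique[rotated])
  also have "\<dots> = S * (\<Prod>r<h. P (2 * r + 1) * P (2 * (t - 1 - r) + 1)) * E ^ h"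
    by (simp add: prod.distrib)
  also have "S = P t * Hstar x (fps_X ^ t)"
    using Hstar_eq[OF X0[OF t0] assms(2)]
    by (simp add: S_def P_def Q_def c_def power_mult[symmetric] mult.commute)
  finally have "sc_gf t x = (P t * (\<Prod>r<h. P (2 * r + 1) * P (2 * (t - 1 - r) + 1))) * Hstar x (fps_X ^ t) * E ^ h"
    by (simp add: mult_ac)
  moreover have "- c = fps_const (1 - x ^ 2)"
    by (simp add: c_def)
  ultimately show ?thesis
    unfolding qpoch_inf_residues[OF t] P_def E_def Q_def h_def by simp
qed

end
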